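(* Let $l\ge 2$ and $d_1,\ldots,d_l\ge 2$ be integers. Let $\mathcal{A}$ be the set of tensor products $S_{1}\otimes\cdots\otimes S_{l}$ of strictly positive linear maps $S_{i}\in GL(d_i)$, $i=1,\ldots,l$. Then: 1. $\mathcal{A}\subset GL_{\otimes}(\otimes_{i=1}^{l}\mathbb{R}^{d_{i}})$ is closed. 2. The map $\Psi:\mathcal{A}\times O_{\otimes}(\otimes_{i=1}^{l}\mathbb{R}^{d_{i}})\rightarrow GL_{\otimes}(\otimes_{i=1}^{l}\mathbb{R}^{d_{i}})$ sending the pair $(S,U)$ to $SU$ is a homeomorphism.
   Context: $\otimes_{i=1}^l\mathbb{R}^{d_i}$ is a Euclidean space with the scalar product $\langle\cdot,\cdot\rangle_H$ determined by $\langle x^1\otimes\cdots\otimes x^l,y^1\otimes\cdots\otimes y^l\rangle_H=\prod_{i=1}^l\langle x^i,y^i\rangle$. A decomposable vector is one of the form $x^1\otimes\cdots\otimes x^l$, $x^i\in\mathbb{R}^{d_i}$. $GL_\otimes(\otimes_{i=1}^l\mathbb{R}^{d_i})$ is the group of linear isomorphisms of $\otimes_{i=1}^l\mathbb{R}^{d_i}$ mapping decomposable vectors to decomposable vectors, with the operator norm topology. $O_\otimes(\otimes_{i=1}^l\mathbb{R}^{d_i})$ is the subgroup of its elements that are orthogonal for $\langle\cdot,\cdot\rangle_H$. A linear map $S:\mathbb{E}\to\mathbb{E}$ on a Euclidean space is strictly positive if it is self-adjoint and $\langle x,Sx\rangle_{\mathbb{E}}>0$ for every non-zero $x\in\mathbb{E}$.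 *)

theory Defs
  imports "Jordan_Normal_Form.Matrix" "HOL-Analysis.Analysis"
begin

text \<open>
  Families of vectors $(x^1,\ldots,x^l)$ with $x^i \in \mathbb{R}^{d_i}$; values of \<open>x\<close> outside
  \<open>{1..l}\<close> are irrelevant.
\<close>

definition vec_families :: "nat \<Rightarrow> (nat \<Rightarrow> nat) \<Rightarrow> (nat \<Rightarrow> real Matrix.vec) set" where
  "vec_families l d = {x. \<forall>i\<in>{1..l}. x i \<in> carrier_vec (d i)}"

text \<open>
  The predicate below says that the Euclidean space \<open>'v\<close>, together with the map
  $(x^1,\ldots,x^l) \mapsto x^1 \otimes\cdots\otimes x^l$ given by \<open>tensor\<close>, is the tensor product
  $\bigotimes_{i=1}^l \mathbb{R}^{d_i}$ with its scalar product $\langle\cdot,\cdot\rangle_H$, which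
  is the inner product of \<open>'v\<close>. The last two conditions make the products of unit vectors an
  orthonormal basis. The tensor product is thus fixed up to a unique isometry compatible with
  \<open>tensor\<close>; since its dimension depends on \<open>l\<close> and \<open>d\<close>, it cannot be a single fixed type.
  See \<open>euclidean_tensor_product_exists\<close> below for its existence.
\<close>

definition euclidean_tensor_product ::
  "nat \<Rightarrow> (nat \<Rightarrow> nat) \<Rightarrow> ((nat \<Rightarrow> real Matrix.vec) \<Rightarrow> 'v::euclidean_space) \<Rightarrow> bool" where
  "euclidean_tensor_product l d tensor \<longleftrightarrow>
     (\<forall>x\<in>vec_families l d. \<forall>i\<in>{1..l}. \<forall>u\<in>carrier_vec (d i). \<forall>v\<in>carrier_vec (d i).
        tensor (x(i := u + v)) = tensor (x(i := u)) + tensor (x(i := v))) \<and>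
     (\<forall>x\<in>vec_families l d. \<forall>i\<in>{1..l}. \<forall>u\<in>carrier_vec (d i). \<forall>c.
        tensor (x(i := c \<cdot>\<^sub>v u)) = c *\<^sub>R tensor (x(i := u))) \<and>
     span (tensor ` vec_families l d) = UNIV \<and>
     (\<forall>x\<in>vec_families l d. \<forall>y\<in>vec_families l d.
        inner (tensor x) (tensor y) = (\<Prod>i\<in>{1..l}. scalar_prod (x i) (y i)))"

definition GL_tensor ::
  "nat \<Rightarrow> (nat \<Rightarrow> nat) \<Rightarrow> ((nat \<Rightarrow> real Matrix.vec) \<Rightarrow> 'v::euclidean_space) \<Rightarrow> ('v \<Rightarrow>\<^sub>L 'v) set" where
  "GL_tensor l d tensor =
     {T. bij (blinfun_apply T) \<and>
         blinfun_apply T ` tensor ` vec_families l d \<subseteq> tensor ` vec_families l d}"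

definition O_tensor ::
  "nat \<Rightarrow> (nat \<Rightarrow> nat) \<Rightarrow> ((nat \<Rightarrow> real Matrix.vec) \<Rightarrow> 'v::euclidean_space) \<Rightarrow> ('v \<Rightarrow>\<^sub>L 'v) set" where
  "O_tensor l d tensor =
     {U \<in> GL_tensor l d tensor. orthogonal_transformation (blinfun_apply U)}"

definition strictly_positive :: "nat \<Rightarrow> real mat \<Rightarrow> bool" where
  "strictly_positive n S \<longleftrightarrow>
     S \<in> carrier_mat n n \<and>
     (\<forall>x\<in>carrier_vec n. \<forall>y\<in>carrier_vec n.
        scalar_prod (S *\<^sub>v x) y = scalar_prod x (S *\<^sub>v y)) \<and>
     (\<forall>x\<in>carrier_vec n. x \<noteq> 0\<^sub>v n \<longrightarrow> scalar_prod x (S *\<^sub>v x) > 0)"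

text \<open>
  \<open>T = S\<^sub>1 \<otimes> \<cdots> \<otimes> S\<^sub>l\<close>. The map \<open>T\<close> with this property exists and is unique, see
  \<open>ex1_is_tensor_of_maps\<close> below.
\<close>

definition is_tensor_of_maps ::
  "nat \<Rightarrow> (nat \<Rightarrow> nat) \<Rightarrow> ((nat \<Rightarrow> real Matrix.vec) \<Rightarrow> 'v::euclidean_space) \<Rightarrow>
     (nat \<Rightarrow> real mat) \<Rightarrow> ('v \<Rightarrow>\<^sub>L 'v) \<Rightarrow> bool" where
  "is_tensor_of_maps l d tensor S T \<longleftrightarrow>
     (\<forall>x\<in>vec_families l d. blinfun_apply T (tensor x) = tensor (\<lambda>i. S i *\<^sub>v x i))"

definition positive_tensors ::
  "nat \<Rightarrow> (nat \<Rightarrow> nat) \<Rightarrow> ((nat \<Rightarrow> real Matrix.vec) \<Rightarrow> 'v::euclidean_space) \<Rightarrow> ('v \<Rightarrow>\<^sub>L 'v) set" where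
  "positive_tensors l d tensor =
     {T. \<exists>S. (\<forall>i\<in>{1..l}. invertible_mat (S i) \<and> strictly_positive (d i) (S i)) \<and>
             is_tensor_of_maps l d tensor S T}"

lemma prod_sum_multi_index:
  fixes f :: "nat \<Rightarrow> nat \<Rightarrow> real"
  shows "(\<Prod>i\<in>{1..l}. \<Sum>j\<in>{..<d i}. f i j) = (\<Sum>k\<in>PiE {1..l} (\<lambda>i. {..<d i}). \<Prod>i\<in>{1..l}. f i (k i))"
  by (rule prod_sum_PiE) auto

lemma scalar_prod_lessThan:
  "v \<in> carrier_vec n \<Longrightarrow> scalar_prod u v = (\<Sum>j\<in>{..<n}. vec_index u j * vec_index v j)"
  by (auto simp: scalar_prod_def atLeast0LessThan)

lemma euclidean_tensor_product_exists:
  assumes dim: "DIM('v) = (\<Prod>i\<in>{1..l}. d i)"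
  shows "\<exists>tensor :: (nat \<Rightarrow> real Matrix.vec) \<Rightarrow> 'v::euclidean_space. euclidean_tensor_product l d tensor"
proof -
  define K where "K = PiE {1..l} (\<lambda>i. {..<d i})"
  have finK: "finite K" unfolding K_def by (intro finite_PiE) auto
  have "card K = DIM('v)" unfolding K_def by (simp add: card_PiE dim)
  then obtain b where b: "bij_betw b K (Basis :: 'v set)"
    using finite_same_card_bij[OF finK finite_Basis] by auto
  define c where "c x k = (\<Prod>i\<in>{1..l}. vec_index (x i) (k i))" for x :: "nat \<Rightarrow> real Matrix.vec" and k
  define t :: "(nat \<Rightarrow> real Matrix.vec) \<Rightarrow> 'v" where "t x = (\<Sum>k\<in>K. c x k *\<^sub>R b k)" for x
  have bB: "b k \<in> Basis" if "k \<in> K" for k using b that by (auto simp: bij_betw_def)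
  have bb: "inner (b k) (b m) = (if k = m then 1 else 0)" if "k \<in> K" "m \<in> K" for k m
    using inj_on_eq_iff[OF bij_betw_imp_inj_on[OF b] that] bB[OF that(1)] bB[OF that(2)]
    by (simp add: inner_Basis)
  have split: "c (x(i := w)) k = vec_index w (k i) * (\<Prod>j\<in>{1..l}-{i}. vec_index (x j) (k j))"
    if "i \<in> {1..l}" for x i w k
    unfolding c_def by (subst prod.remove[of _ i]) (use that in auto)
  have kd: "k i < d i" if "k \<in> K" "i \<in> {1..l}" for k i using that by (auto simp: K_def PiE_def)
  have add: "t (x(i := u + v)) = t (x(i := u)) + t (x(i := v))"
    if "i \<in> {1..l}" "u \<in> carrier_vec (d i)" "v \<in> carrier_vec (d i)" for x i u v
    unfolding t_def sum.distrib[symmetric]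
    by (intro sum.cong refl) (use that kd in \<open>auto simp: split algebra_simps\<close>)
  have scale: "t (x(i := a \<cdot>\<^sub>v u)) = a *\<^sub>R t (x(i := u))"
    if "i \<in> {1..l}" "u \<in> carrier_vec (d i)" for x i u a
    unfolding t_def scaleR_sum_right
    by (intro sum.cong refl) (use that kd in \<open>auto simp: split algebra_simps\<close>)
  have tb: "t (\<lambda>i. unit_vec (d i) (k i)) = b k" if k: "k \<in> K" for k
  proof -
    have "c (\<lambda>i. unit_vec (d i) (k i)) m = (if m = k then 1 else 0)" if m: "m \<in> K" for m
    proof (cases "m = k")
      case True
      then show ?thesis unfolding c_def using kd[OF k] by (auto intro!: prod.neutral)
    next
      case False
      then obtain i where i: "i \<in> {1..l}" "m i \<noteq> k i"
        using k m unfolding K_def by (metis PiE_ext)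
      have "vec_index (unit_vec (d i) (k i) :: real Matrix.vec) (m i) = 0"
        using i kd[OF k] kd[OF m] by auto
      then have "c (\<lambda>i. unit_vec (d i) (k i)) m = 0"
        unfolding c_def using i(1) by (intro prod_zero) auto
      then show ?thesis using False by simp
    qed
    then have "t (\<lambda>i. unit_vec (d i) (k i)) = (\<Sum>m\<in>K. (if m = k then 1 else 0) *\<^sub>R b m)"
      unfolding t_def by (intro sum.cong) auto
    also have "\<dots> = (\<Sum>m\<in>K. if m = k then b m else 0)" by (intro sum.cong) auto
    also have "\<dots> = b k" using k finK by simp
    finally show ?thesis .
  qed
  have "Basis \<subseteq> t ` vec_families l d"
  proof
    fix e :: 'v assume "e \<in> Basis"
    then obtain k where "k \<in> K" "e = b k" using b by (auto simp: bij_betw_def)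
    then show "e \<in> t ` vec_families l d"
      using tb by (auto simp: vec_families_def intro!: image_eqI[of _ _ "\<lambda>i. unit_vec (d i) (k i)"])
  qed
  then have sp: "span (t ` vec_families l d) = UNIV"
    by (metis span_Basis span_mono top.extremum_uniqueI)
  have inn: "inner (t x) (t y) = (\<Prod>i\<in>{1..l}. scalar_prod (x i) (y i))"
    if "x \<in> vec_families l d" "y \<in> vec_families l d" for x y
  proof -
    have "inner (t x) (t y) = (\<Sum>k\<in>K. \<Sum>m\<in>K. c x k * (c y m * inner (b k) (b m)))"
      by (simp add: t_def inner_sum_left inner_sum_right sum_distrib_left)
         (subst sum.swap, intro sum.cong refl, simp add: algebra_simps)
    also have "\<dots> = (\<Sum>k\<in>K. \<Sum>m\<in>K. if m = k then c x k * c y k else 0)"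
      by (intro sum.cong refl) (auto simp: bb)
    also have "\<dots> = (\<Sum>k\<in>K. c x k * c y k)" using finK by simp
    also have "\<dots> = (\<Prod>i\<in>{1..l}. \<Sum>j\<in>{..<d i}. vec_index (x i) j * vec_index (y i) j)"
      unfolding prod_sum_multi_index K_def c_def prod.distrib ..
    also have "\<dots> = (\<Prod>i\<in>{1..l}. scalar_prod (x i) (y i))"
      using that
      by (intro prod.cong refl scalar_prod_lessThan[symmetric]) (auto simp: vec_families_def)
    finally show ?thesis .
  qed
  show ?thesis
    using add scale sp inn by (intro exI[of _ t]) (auto simp: euclidean_tensor_product_def)
qed

lemma ex1_is_tensor_of_maps:
  fixes tensor :: "(nat \<Rightarrow> real Matrix.vec) \<Rightarrow> 'v::euclidean_space"
  assumes tp: "euclidean_tensor_product l d tensor"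
    and S: "\<And>i. i \<in> {1..l} \<Longrightarrow> S i \<in> carrier_mat (d i) (d i)"
  shows "\<exists>!T. is_tensor_of_maps l d tensor S T"
proof -
  define K where "K = PiE {1..l} (\<lambda>i. {..<d i})"
  have sp: "span (tensor ` vec_families l d) = UNIV"
    and inn: "\<And>x y. x \<in> vec_families l d \<Longrightarrow> y \<in> vec_families l d \<Longrightarrow>
        inner (tensor x) (tensor y) = (\<Prod>i\<in>{1..l}. scalar_prod (x i) (y i))"
    using tp by (auto simp: euclidean_tensor_product_def)
  define e where "e k i = (unit_vec (d i) (k i) :: real Matrix.vec)" for k i
  have eX: "e k \<in> vec_families l d" for k by (auto simp: vec_families_def e_def)
  have SX: "(\<lambda>i. S i *\<^sub>v x i) \<in> vec_families l d" if "x \<in> vec_families l d" for x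
    using that S by (auto simp: vec_families_def intro!: mult_mat_vec_carrier)
  define T where "T v = (\<Sum>k\<in>K. inner v (tensor (e k)) *\<^sub>R tensor (\<lambda>i. S i *\<^sub>v e k i))" for v
  have lin: "linear T"
    unfolding T_def by (intro linearI) (auto simp: inner_add_left scaleR_add_left sum.distrib scaleR_sum_right)
  have main: "inner (T (tensor x)) (tensor y) = inner (tensor (\<lambda>i. S i *\<^sub>v x i)) (tensor y)"
    if x: "x \<in> vec_families l d" and y: "y \<in> vec_families l d" for x y
  proof -
    have 1: "scalar_prod (S i *\<^sub>v x i) (y i) =
        (\<Sum>j\<in>{..<d i}. scalar_prod (x i) (unit_vec (d i) j) * scalar_prod (S i *\<^sub>v unit_vec (d i) j) (y i))"
      if i: "i \<in> {1..l}" for i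
    proof -
      have c: "x i \<in> carrier_vec (d i)" "y i \<in> carrier_vec (d i)" "S i \<in> carrier_mat (d i) (d i)"
        using x y S i by (auto simp: vec_families_def)
      have "scalar_prod (S i *\<^sub>v x i) (y i) =
          (\<Sum>a\<in>{..<d i}. (\<Sum>j\<in>{..<d i}. S i $$ (a, j) * vec_index (x i) j) * vec_index (y i) a)"
        using c by (auto simp: scalar_prod_def mult_mat_vec_def atLeast0LessThan intro!: sum.cong)
      also have "\<dots> = (\<Sum>j\<in>{..<d i}. vec_index (x i) j * (\<Sum>a\<in>{..<d i}. S i $$ (a, j) * vec_index (y i) a))"
        unfolding sum_distrib_left sum_distrib_right
        by (subst sum.swap) (auto intro!: sum.cong)
      also have "\<dots> = (\<Sum>j\<in>{..<d i}. scalar_prod (x i) (unit_vec (d i) j) * scalar_prod (S i *\<^sub>v unit_vec (d i) j) (y i))"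
      proof (intro sum.cong refl)
        fix j assume j: "j \<in> {..<d i}"
        have "scalar_prod (x i) (unit_vec (d i) j) = vec_index (x i) j"
          using c j by (auto simp: scalar_prod_right_unit)
        moreover have "scalar_prod (S i *\<^sub>v unit_vec (d i) j) (y i) = (\<Sum>a\<in>{..<d i}. S i $$ (a, j) * vec_index (y i) a)"
          using c j by (auto simp: scalar_prod_lessThan intro!: sum.cong)
        ultimately show "vec_index (x i) j * (\<Sum>a\<in>{..<d i}. S i $$ (a, j) * vec_index (y i) a) =
          scalar_prod (x i) (unit_vec (d i) j) * scalar_prod (S i *\<^sub>v unit_vec (d i) j) (y i)" by simp
      qed
      finally show ?thesis .
    qed
    have "inner (tensor (\<lambda>i. S i *\<^sub>v x i)) (tensor y) = (\<Prod>i\<in>{1..l}. scalar_prod (S i *\<^sub>v x i) (y i))"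
      using inn[OF SX[OF x] y] .
    also have "\<dots> = (\<Prod>i\<in>{1..l}. \<Sum>j\<in>{..<d i}. scalar_prod (x i) (unit_vec (d i) j) * scalar_prod (S i *\<^sub>v unit_vec (d i) j) (y i))"
      by (intro prod.cong refl 1)
    also have "\<dots> = (\<Sum>k\<in>K. (\<Prod>i\<in>{1..l}. scalar_prod (x i) (e k i)) * (\<Prod>i\<in>{1..l}. scalar_prod (S i *\<^sub>v e k i) (y i)))"
      unfolding prod_sum_multi_index K_def e_def prod.distrib ..
    also have "\<dots> = inner (T (tensor x)) (tensor y)"
      unfolding T_def inner_sum_left using inn[OF x eX] inn[OF SX[OF eX] y]
      by simp
    finally show ?thesis by simp
  qed
  have ext: "v = w" if "\<And>y. y \<in> vec_families l d \<Longrightarrow> inner v (tensor y) = inner w (tensor y)" for v w :: 'v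
  proof -
    have "inner (v - w) z = 0" if "z \<in> span (tensor ` vec_families l d)" for z
      using that
      by (induction rule: span_induct_alt)
         (use \<open>\<And>y. y \<in> vec_families l d \<Longrightarrow> inner v (tensor y) = inner w (tensor y)\<close> in
           \<open>auto simp: inner_diff_left inner_add_right\<close>)
    then have "inner (v - w) (v - w) = 0" using sp by auto
    then show ?thesis by simp
  qed
  have bl: "blinfun_apply (Blinfun T) = T"
    using lin by (intro bounded_linear_Blinfun_apply) (simp add: linear_conv_bounded_linear)
  have "is_tensor_of_maps l d tensor S (Blinfun T)"
    unfolding is_tensor_of_maps_def bl using main by (auto intro!: ext)
  moreover have "T1 = T2" if "is_tensor_of_maps l d tensor S T1" "is_tensor_of_maps l d tensor S T2" for T1 T2
  proof (rule blinfun_eqI)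
    fix v :: 'v
    have "v \<in> span (tensor ` vec_families l d)" using sp by auto
    then show "blinfun_apply T1 v = blinfun_apply T2 v"
      by (induction rule: span_induct_alt)
         (use that in \<open>auto simp: is_tensor_of_maps_def blinfun.add_right blinfun.scaleR_right\<close>)
  qed
  ultimately show ?thesis by auto
qed

end

theory Submission
  imports Defs "Jordan_Normal_Form.Determinant"
begin

text \<open>
  A bijective linear \<open>T\<close> preserving decomposable vectors permutes the factors up to linear maps:
  a sum of two decomposable vectors is decomposable only if they differ, up to scaling, in at most one
  factor, so varying the \<open>i\<close>-th factor of \<open>x\<close> varies a single factor \<open>\<sigma> i\<close> of \<open>T x\<close>, and \<open>\<sigma>\<close>
  is a permutation because \<open>T\<close> is onto. Hence \<open>T\<close> maps the tensor of \<open>x\<close> to the tensor of the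
  \<open>B j x (\<sigma>\<^sup>-\<^sup>1 j)\<close>, the operator \<open>T T\<^sup>*\<close> is the tensor product of the strictly positive
  \<open>B j (B j)\<^sup>*\<close>, and \<open>S = \<Otimes> (B j (B j)\<^sup>*)\<^sup>1\<^sup>/\<^sup>2\<close>, \<open>U = S\<^sup>-\<^sup>1 T\<close> is a polar decomposition of the
  required kind. Uniqueness of polar decompositions and continuity of the inverse of \<open>\<Psi>\<close> follow from
  one estimate: if \<open>x\<close> is a unit eigenvector of \<open>S - S'\<close> whose eigenvalue \<open>\<lambda>\<close> has the largest
  modulus, then \<open>\<lambda> \<langle>x, (S + S') x\<rangle> = \<bar>S x\<bar>\<^sup>2 - \<bar>S' x\<bar>\<^sup>2\<close>, and \<open>\<bar>\<bar>S x\<bar> - \<bar>S' x\<bar>\<bar>\<close> is at most the norm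
  of \<open>S U - S' U'\<close>. Uniqueness also shows that \<open>\<A>\<close> consists of the self-adjoint positive semidefinite
  elements of \<open>GL\<^sub>\<otimes>\<close>, so it is closed.
\<close>

section \<open>Positive operators\<close>

text \<open>A unit vector \<open>x\<close> maximizing \<open>norm (D x)\<close> satisfies
  \<open>D (D x) = L^2 *\<^sub>R x\<close> with \<open>L = norm D\<close>. So \<open>D - L\<close>
  kills \<open>D x + L *\<^sub>R x\<close>, which is an eigenvector for \<open>L\<close> unless it
  is zero; in that case \<open>x\<close> is one for \<open>- L\<close>.\<close>

lemma self_adjoint_norm_eigenvector:
  fixes D :: "'v::euclidean_space \<Rightarrow>\<^sub>L 'v"
  assumes sa: "\<And>x y. inner (D x) y = inner x (D y)"
  obtains x c where "norm x = 1" "D x = c *\<^sub>R x" "\<bar>c\<bar> = norm D"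
proof -
  have ne: "sphere (0::'v) 1 \<noteq> {}" by simp
  have "continuous_on (sphere 0 1) (\<lambda>x. norm (D x))"
    by (intro continuous_intros)
  from continuous_attains_sup[OF compact_sphere ne this]
  obtain x where x: "norm x = 1" and max: "\<And>y. norm y = 1 \<Longrightarrow> norm (D y) \<le> norm (D x)"
    by auto
  define L where "L = norm (D x)"
  have "norm D \<le> L"
  proof (rule norm_blinfun_bound)
    show "0 \<le> L" by (simp add: L_def)
    fix y show "norm (D y) \<le> L * norm y"
    proof (cases "y = 0")
      case False
      have "norm (D (y /\<^sub>R norm y)) \<le> L" unfolding L_def by (rule max) (use False in simp)
      then show ?thesis using False by (simp add: blinfun.scaleR_right field_simps)
    qed (simp add: blinfun.zero_right)
  qed
  moreover have "L \<le> norm D" unfolding L_def using norm_blinfun[of D x] x by simp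
  ultimately have L: "norm D = L" by simp
  \<comment> \<open>With \<open>norm (D (D x)) \<le> L^2\<close>, the expanded square is at most
    \<open>L^4 - 2 * L^4 + L^4 = 0\<close>.\<close>
  have "norm (D (D x) - L^2 *\<^sub>R x)^2 = norm (D (D x))^2 - 2 * L^2 * inner (D (D x)) x + L^4"
    using x unfolding power2_norm_eq_inner norm_eq_1
    by (simp add: inner_diff_left inner_diff_right inner_commute algebra_simps power2_eq_square power4_eq_xxxx)
  also have "inner (D (D x)) x = L^2" by (simp add: sa L_def power2_norm_eq_inner)
  also have "norm (D (D x)) \<le> L * L" using norm_blinfun[of D "D x"] L by (simp add: L_def)
  then have "norm (D (D x))^2 \<le> L^4"
    using power_mono[of "norm (D (D x))" "L * L" 2] by (simp add: power4_eq_xxxx power2_eq_square algebra_simps)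
  finally have "norm (D (D x) - L^2 *\<^sub>R x)^2 \<le> 0"
    by (simp add: power4_eq_xxxx power2_eq_square)
  then have DD: "D (D x) = L^2 *\<^sub>R x" by simp
  show ?thesis
  proof (cases "D x + L *\<^sub>R x = 0")
    case True
    then have "D x = (- L) *\<^sub>R x" by (simp add: eq_neg_iff_add_eq_0)
    then show ?thesis using x L that[of x "- L"] by (simp add: L_def)
  next
    case False
    define y where "y = D x + L *\<^sub>R x"
    have "D y = L *\<^sub>R y"
      by (simp add: y_def blinfun.add_right blinfun.scaleR_right DD algebra_simps power2_eq_square)
    then have "D (y /\<^sub>R norm y) = L *\<^sub>R (y /\<^sub>R norm y)"
      by (simp add: blinfun.scaleR_right)
    then show ?thesis using that[of "y /\<^sub>R norm y" L] False L by (simp add: y_def L_def)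
  qed
qed

text \<open>With \<open>C = 1 - P / \<parallel>P\<parallel>\<close>, a solution of \<open>Y = (C + Y\<^sup>2) / 2\<close> satisfies \<open>(1 - Y)\<^sup>2 = P / \<parallel>P\<parallel>\<close>, and
  the right hand side is a contraction of the ball of radius \<open>\<parallel>C\<parallel> < 1\<close>.\<close>

lemma positive_operator_sqrt:
  fixes P :: "'v::euclidean_space \<Rightarrow>\<^sub>L 'v" and M :: "('v \<Rightarrow>\<^sub>L 'v) set"
  assumes cl: "closed M" and sub: "subspace M" and one: "id_blinfun \<in> M" and PM: "P \<in> M"
    and sq: "\<And>X. X \<in> M \<Longrightarrow> X o\<^sub>L X \<in> M"
    and sa: "\<And>X x y. X \<in> M \<Longrightarrow> inner (X x) y = inner x (X y)"
    and pos: "\<And>x. x \<noteq> 0 \<Longrightarrow> inner x (P x) > 0"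
  obtains R where "R \<in> M" "R o\<^sub>L R = P" "\<And>x. x \<noteq> 0 \<Longrightarrow> inner x (R x) > 0"
proof -
  have "P \<noteq> 0"
  proof
    assume "P = 0"
    obtain b :: 'v where "b \<in> Basis" using nonempty_Basis by blast
    then have "b \<noteq> 0" by auto
    from pos[OF this] \<open>P = 0\<close> show False by simp
  qed
  define K where "K = norm P"
  have K: "K > 0" using \<open>P \<noteq> 0\<close> by (simp add: K_def)
  define C where "C = id_blinfun - P /\<^sub>R K"
  have CM: "C \<in> M" unfolding C_def by (intro subspace_diff subspace_scale sub one PM)
  define r where "r = norm C"
  have r0: "r \<ge> 0" by (simp add: r_def)
  \<comment> \<open>\<open>r\<close> is the modulus of an eigenvalue
    \<open>1 - inner x (P x) / K\<close> of \<open>C\<close> with a unit vector \<open>x\<close>;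
    positivity and Cauchy-Schwarz put the quotient into the interval from 0 (excluded) to 1.\<close>
  have r1: "r < 1"
  proof -
    obtain x c where x: "norm x = 1" "C x = c *\<^sub>R x" "\<bar>c\<bar> = norm C"
      using self_adjoint_norm_eigenvector[OF sa[OF CM]] by metis
    have xx: "inner x x = 1" using x(1) by (simp add: norm_eq_1)
    have "c = inner x (C x)" using x xx by simp
    also have "\<dots> = 1 - inner x (P x) / K"
      by (simp add: C_def blinfun.diff_left blinfun.scaleR_left inner_diff_right xx divide_inverse mult.commute)
    finally have c: "c = 1 - inner x (P x) / K" .
    have "inner x (P x) \<le> norm x * norm (P x)" by (rule norm_cauchy_schwarz)
    also have "\<dots> \<le> K" using norm_blinfun[of P x] x by (simp add: K_def)
    finally have "inner x (P x) / K \<le> 1" using K by simp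
    moreover have "inner x (P x) / K > 0" using pos[of x] x(1) K by force
    ultimately show ?thesis using c x(3) by (simp add: r_def)
  qed
  define f where "f Y = (C + (Y o\<^sub>L Y)) /\<^sub>R 2" for Y :: "'v \<Rightarrow>\<^sub>L 'v"
  have "\<exists>!Y\<in>cball 0 r \<inter> M. f Y = Y"
  proof (rule Banach_fix[OF _ _ r0 r1])
    show "complete (cball 0 r \<inter> M)" using cl by (simp add: complete_eq_closed closed_Int)
    show "cball 0 r \<inter> M \<noteq> {}" using r0 subspace_0[OF sub] by (metis IntI empty_iff mem_cball_0 norm_zero)
    show "f ` (cball 0 r \<inter> M) \<subseteq> cball 0 r \<inter> M"
    proof (rule image_subsetI)
      fix Y assume Y: "Y \<in> cball 0 r \<inter> M"
      then have n: "norm Y \<le> r" by simp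
      have "norm (C + (Y o\<^sub>L Y)) \<le> r + norm Y * norm Y"
        using norm_triangle_ineq[of C "Y o\<^sub>L Y"] norm_blinfun_compose[of Y Y] by (simp add: r_def)
      also have "\<dots> \<le> r + r * r" using n by (intro add_mono mult_mono) (auto simp: r_def)
      also have "r * r \<le> r * 1" using r0 r1 by (intro mult_left_mono) auto
      finally have "norm (f Y) \<le> r" by (simp add: f_def)
      moreover have "f Y \<in> M" using Y unfolding f_def by (intro subspace_scale subspace_add sub CM sq) auto
      ultimately show "f Y \<in> cball 0 r \<inter> M" by simp
    qed
  next
    fix Y Z assume "Y \<in> cball 0 r \<inter> M" "Z \<in> cball 0 r \<inter> M"
    then have n: "norm Y \<le> r" "norm Z \<le> r" by auto
    \<comment> \<open>A difference of squares without commutativity: each of the two products is at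
      most \<open>r\<close> times the distance of \<open>Y\<close> and \<open>Z\<close>, and the
      factor 1/2 averages them.\<close>
    have "f Y - f Z = ((Y o\<^sub>L (Y - Z)) + ((Y - Z) o\<^sub>L Z)) /\<^sub>R 2"
      by (rule blinfun_eqI)
         (simp add: f_def blinfun.diff_left blinfun.diff_right blinfun.add_left blinfun.scaleR_left scaleR_diff_right[symmetric])
    then have "dist (f Y) (f Z) = norm ((Y o\<^sub>L (Y - Z)) + ((Y - Z) o\<^sub>L Z)) / 2"
      by (simp add: dist_norm)
    also have "\<dots> \<le> (norm Y * norm (Y - Z) + norm (Y - Z) * norm Z) / 2"
      by (intro divide_right_mono order_trans[OF norm_triangle_ineq] add_mono norm_blinfun_compose) auto
    also have "\<dots> \<le> (r * norm (Y - Z) + norm (Y - Z) * r) / 2"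
      using n r0 by (intro divide_right_mono add_mono mult_mono) auto
    finally show "dist (f Y) (f Z) \<le> r * dist Y Z" by (simp add: dist_norm)
  qed
  then obtain Y where Y: "norm Y \<le> r" "Y \<in> M" "f Y = Y" by auto
  have YY: "C x + Y (Y x) = 2 *\<^sub>R Y x" for x
  proof -
    have "Y x = f Y x" by (simp add: Y(3))
    also have "\<dots> = (C x + Y (Y x)) /\<^sub>R 2" by (simp add: f_def blinfun.scaleR_left blinfun.add_left)
    finally show ?thesis by (metis scaleR_half_double scaleR_left_imp_eq scaleR_scaleR divideR_right zero_neq_numeral)
  qed
  define R where "R = sqrt K *\<^sub>R (id_blinfun - Y)"
  have "R \<in> M" unfolding R_def by (intro subspace_scale subspace_diff sub one Y)
  moreover have "R o\<^sub>L R = P"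
  proof (rule blinfun_eqI)
    fix x
    have "R (R x) = K *\<^sub>R (x - 2 *\<^sub>R Y x + Y (Y x))"
      using K by (simp add: R_def blinfun.scaleR_left blinfun.scaleR_right blinfun.diff_left blinfun.diff_right
          algebra_simps scaleR_2)
    also have "x - 2 *\<^sub>R Y x + Y (Y x) = x - C x" using YY[of x] by (simp add: algebra_simps)
    also have "\<dots> = P x /\<^sub>R K" by (simp add: C_def blinfun.diff_left blinfun.scaleR_left)
    finally show "(R o\<^sub>L R) x = P x" using K by simp
  qed
  moreover have "inner x (R x) > 0" if "x \<noteq> 0" for x
  proof -
    have "inner x (Y x) \<le> norm x * norm (Y x)" by (rule norm_cauchy_schwarz)
    also have "\<dots> \<le> norm x * (r * norm x)"
      by (intro mult_left_mono order_trans[OF norm_blinfun mult_right_mono[OF Y(1)]]) auto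
    also have "\<dots> < inner x x" using r1 that
      by (simp add: power2_norm_eq_inner[symmetric] power2_eq_square)
    finally show ?thesis using K by (simp add: R_def blinfun.scaleR_left blinfun.diff_left inner_diff_right)
  qed
  ultimately show ?thesis using that by blast
qed

text \<open>Only \<open>S\<close> has to be bounded below; \<open>S'\<close> may be merely
  semidefinite, which the closedness argument uses. The right hand side involves only
  \<open>S\<close> and the error \<open>e\<close>, so for fixed \<open>S\<close> it tends to zero
  with \<open>e\<close>.\<close>

lemma polar_decomposition_estimate:
  fixes S S' U U' :: "'v::euclidean_space \<Rightarrow>\<^sub>L 'v"
  assumes S: "\<And>x y. inner (S x) y = inner x (S y)" and S': "\<And>x y. inner (S' x) y = inner x (S' y)"
    and U: "orthogonal_transformation (blinfun_apply U)" and U': "orthogonal_transformation (blinfun_apply U')"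
    and m: "\<And>x. m * (norm x)^2 \<le> inner x (S x)" and p: "\<And>x. 0 \<le> inner x (S' x)"
  defines "e \<equiv> norm ((S o\<^sub>L U) - (S' o\<^sub>L U'))"
  shows "m * norm (S - S') \<le> e * (2 * norm S + e)"
proof -
  \<comment> \<open>Write \<open>A x = V z\<close> with \<open>norm z = norm (A x)\<close>. Then the
    square of \<open>norm (A x)\<close> is \<open>inner x (A (V z))\<close>, and replacing
    \<open>A V\<close> by \<open>B W\<close> costs at most the norm of their difference.\<close>
  have aux: "norm (A x) \<le> norm (B x) + norm ((A o\<^sub>L V) - (B o\<^sub>L W)) * norm x"
    if A: "\<And>x y. inner (A x) y = inner x (A y)" and B: "\<And>x y. inner (B x) y = inner x (B y)"
      and V: "orthogonal_transformation (blinfun_apply V)" and W: "orthogonal_transformation (blinfun_apply W)"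
    for A B V W :: "'v \<Rightarrow>\<^sub>L 'v" and x
  proof -
    obtain z where z: "A x = V z" using orthogonal_transformation_surj[OF V] by (metis surjD)
    have nz: "norm z = norm (A x)" using orthogonal_transformation_norm[OF V, of z] z by simp
    have nW: "norm (W z) = norm (A x)" using orthogonal_transformation_norm[OF W, of z] nz by simp
    have "(norm (A x))^2 = inner x ((A o\<^sub>L V) z)" by (simp only: power2_norm_eq_inner A) (simp add: z)
    also have "\<dots> = inner (B x) (W z) + inner x (((A o\<^sub>L V) - (B o\<^sub>L W)) z)"
      by (simp add: B blinfun.diff_left inner_diff_right)
    also have "\<dots> \<le> norm (B x) * norm (A x) + norm x * (norm ((A o\<^sub>L V) - (B o\<^sub>L W)) * norm (A x))"
      using norm_cauchy_schwarz[of "B x" "W z"] nW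
        norm_cauchy_schwarz[of x "((A o\<^sub>L V) - (B o\<^sub>L W)) z"]
        mult_left_mono[OF norm_blinfun[of "(A o\<^sub>L V) - (B o\<^sub>L W)" z] norm_ge_zero[of x]] nz
      by simp
    finally have "norm (A x) * norm (A x) \<le> (norm (B x) + norm ((A o\<^sub>L V) - (B o\<^sub>L W)) * norm x) * norm (A x)"
      by (simp add: power2_eq_square algebra_simps)
    then show ?thesis
      by (metis mult_le_cancel_right norm_ge_zero order_le_less add_nonneg_nonneg mult_nonneg_nonneg)
  qed
  have sa: "inner ((S - S') x) y = inner x ((S - S') y)" for x y
    by (simp add: blinfun.diff_left inner_diff_left inner_diff_right S S')
  obtain x c where x: "norm x = 1" "(S - S') x = c *\<^sub>R x" "\<bar>c\<bar> = norm (S - S')"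
    using self_adjoint_norm_eigenvector[OF sa] by metis
  have e: "\<bar>norm (S x) - norm (S' x)\<bar> \<le> e"
    using aux[OF S S' U U', of x] aux[OF S' S U' U, of x] x(1) by (simp add: e_def norm_minus_commute)
  have e0: "e \<ge> 0" by (simp add: e_def)
  have cx: "c *\<^sub>R x = S x - S' x" using x(2) by (simp add: blinfun.diff_left)
  have "c * (inner x (S x) + inner x (S' x)) = inner (c *\<^sub>R x) (S x + S' x)"
    by (simp add: inner_add_right algebra_simps)
  also have "\<dots> = (norm (S x))^2 - (norm (S' x))^2"
    unfolding cx by (simp add: power2_norm_eq_inner inner_add_right inner_diff_left inner_diff_right inner_commute)
  finally have "\<bar>c\<bar> * \<bar>inner x (S x) + inner x (S' x)\<bar> = \<bar>(norm (S x))^2 - (norm (S' x))^2\<bar>"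
    by (simp add: abs_mult[symmetric])
  also have "\<dots> = \<bar>norm (S x) - norm (S' x)\<bar> * (norm (S x) + norm (S' x))"
    by (simp add: power2_eq_square square_diff_square_factored abs_mult)
  \<comment> \<open>Here \<open>norm (S' x)\<close> is bounded by \<open>norm (S x) + e\<close>,
    hence by \<open>norm S + e\<close>.\<close>
  also have "\<dots> \<le> e * (2 * norm S + e)"
    using e e0 norm_blinfun[of S x] x(1) by (intro mult_mono) auto
  finally have "\<bar>c\<bar> * \<bar>inner x (S x) + inner x (S' x)\<bar> \<le> e * (2 * norm S + e)" .
  moreover have "\<bar>c\<bar> * m \<le> \<bar>c\<bar> * \<bar>inner x (S x) + inner x (S' x)\<bar>"
    using m[of x] p[of x] x(1) by (intro mult_left_mono) auto
  ultimately show ?thesis using x(3) by (simp add: mult.commute)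
qed

text \<open>The quadratic form attains a positive minimum on the compact unit sphere, and scaling
  extends the bound to all vectors.\<close>

lemma positive_lower_bound:
  fixes S :: "'v::euclidean_space \<Rightarrow>\<^sub>L 'v"
  assumes pos: "\<And>x. x \<noteq> 0 \<Longrightarrow> inner x (S x) > 0"
  obtains m where "m > 0" "\<And>x. m * (norm x)^2 \<le> inner x (S x)"
proof -
  have ne: "sphere (0::'v) 1 \<noteq> {}" by simp
  have "continuous_on (sphere 0 1) (\<lambda>x. inner x (S x))" by (intro continuous_intros)
  from continuous_attains_inf[OF compact_sphere ne this]
  obtain z where z: "norm z = 1" and min: "\<And>y. norm y = 1 \<Longrightarrow> inner z (S z) \<le> inner y (S y)"
    by auto
  have "inner z (S z) * (norm x)^2 \<le> inner x (S x)" for x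
  proof (cases "x = 0")
    case False
    have "inner z (S z) \<le> inner (x /\<^sub>R norm x) (S (x /\<^sub>R norm x))" by (rule min) (use False in simp)
    also have "\<dots> = inner x (S x) / (norm x)^2"
      by (simp add: blinfun.scaleR_right power2_eq_square divide_inverse)
    finally show ?thesis using False by (simp add: field_simps)
  qed (simp add: blinfun.zero_right)
  moreover have "inner z (S z) > 0" using z by (intro pos) auto
  ultimately show ?thesis using that by blast
qed

lemma norm_orthogonal_le_1:
  fixes U :: "'v::euclidean_space \<Rightarrow>\<^sub>L 'v"
  assumes "orthogonal_transformation (blinfun_apply U)"
  shows "norm U \<le> 1"
  using orthogonal_transformation_norm[OF assms] by (intro norm_blinfun_bound) auto

lemma linear_blinfun: "linear (blinfun_apply X)"
  by (rule bounded_linear.linear[OF blinfun.bounded_linear_right])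

lemma bij_blinfunI:
  fixes X Y :: "'v::euclidean_space \<Rightarrow>\<^sub>L 'v"
  assumes "X o\<^sub>L Y = id_blinfun" "Y o\<^sub>L X = id_blinfun"
  shows "bij (blinfun_apply X)"
proof (rule bij_betw_byWitness[where f' = "blinfun_apply Y"])
  show "\<forall>x\<in>UNIV. Y (X x) = x" "\<forall>x\<in>UNIV. X (Y x) = x"
    using assms by (metis blinfun_apply_blinfun_compose blinfun_apply_id_blinfun id_apply)+
qed auto

section \<open>Square roots of matrices\<close>

lemma scalar_prod_self_pos:
  assumes "u \<in> carrier_vec n" "u \<noteq> 0\<^sub>v n"
  shows "0 < scalar_prod u (u :: real Matrix.vec)"
proof -
  obtain i where "i < n" "vec_index u i \<noteq> 0" using assms by (metis carrier_vecD eq_vecI index_zero_vec)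
  then show ?thesis using assms(1) unfolding scalar_prod_def
    by (intro sum_pos2[of _ i]) (auto simp: less_le)
qed

lemma scalar_prod_self_eq_0_iff:
  assumes "u \<in> carrier_vec n"
  shows "scalar_prod u (u :: real Matrix.vec) = 0 \<longleftrightarrow> u = 0\<^sub>v n"
  using scalar_prod_self_pos[OF assms] assms by force

lemma eq_mat_mult_vecI:
  fixes A B :: "'a::comm_ring_1 mat"
  assumes A: "A \<in> carrier_mat m n" and B: "B \<in> carrier_mat m n"
    and eq: "\<And>u. u \<in> carrier_vec n \<Longrightarrow> A *\<^sub>v u = B *\<^sub>v u"
  shows "A = B"
proof (rule mat_col_eqI)
  fix j assume "j < dim_col B"
  then have j: "j < n" using B by simp
  have "col A j = A *\<^sub>v unit_vec n j" "col B j = B *\<^sub>v unit_vec n j"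
    using A B j by (auto intro!: eq_vecI)
  then show "col A j = col B j" by (simp add: eq)
qed (use A B in auto)

text \<open>Definiteness forces a trivial kernel, hence a nonzero determinant.\<close>

lemma strictly_positive_inverse:
  assumes "strictly_positive n S"
  obtains B where "B \<in> carrier_mat n n" "S * B = 1\<^sub>m n" "B * S = 1\<^sub>m n"
proof -
  have S: "S \<in> carrier_mat n n" using assms by (simp add: strictly_positive_def)
  have "det S \<noteq> 0"
  proof
    assume "det S = 0"
    then obtain v where "v \<in> carrier_vec n" "v \<noteq> 0\<^sub>v n" "S *\<^sub>v v = 0\<^sub>v n"
      using det_0_iff_vec_prod_zero_field[OF S] by auto
    then show False using assms by (auto simp: strictly_positive_def)
  qed
  from det_non_zero_imp_unit[OF S this, of n]
  show ?thesis using that by (auto simp: Units_def ring_mat_def)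
qed

lemma strictly_positive_invertible_mat:
  assumes "strictly_positive n S"
  shows "invertible_mat S"
proof -
  have "S \<in> carrier_mat n n" using assms by (simp add: strictly_positive_def)
  moreover obtain B where "B \<in> carrier_mat n n" "S * B = 1\<^sub>m n" "B * S = 1\<^sub>m n"
    using strictly_positive_inverse[OF assms] .
  ultimately show ?thesis by (auto simp: invertible_mat_def inverts_mat_def)
qed

lemma mat_mult_transpose_scalar_prod:
  fixes B :: "real mat"
  assumes B: "B \<in> carrier_mat m n" and x: "x \<in> carrier_vec m" and y: "y \<in> carrier_vec n"
  shows "scalar_prod x (B *\<^sub>v y) = scalar_prod (transpose_mat B *\<^sub>v x) y"
  using transpose_vec_mult_scalar[OF B y x] by simp

text \<open>The coordinate space is embedded by \<open>b\<close> into a Euclidean space type, where \<open>P\<close> is extended by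
  the identity on the orthogonal complement; the square root of the extension commutes with the
  orthogonal projection and hence restricts to the image of the embedding.\<close>

lemma strictly_positive_sqrt:
  fixes b :: "nat \<Rightarrow> 'v::euclidean_space"
  assumes P: "strictly_positive n P"
    and b: "\<And>i j. i < n \<Longrightarrow> j < n \<Longrightarrow> inner (b i) (b j) = (if i = j then 1 else 0)"
  obtains S where "strictly_positive n S" "S * S = P"
proof -
  have Pc: "P \<in> carrier_mat n n"
    and Psa: "\<And>x y. x \<in> carrier_vec n \<Longrightarrow> y \<in> carrier_vec n \<Longrightarrow> scalar_prod (P *\<^sub>v x) y = scalar_prod x (P *\<^sub>v y)"
    and Ppos: "\<And>x. x \<in> carrier_vec n \<Longrightarrow> x \<noteq> 0\<^sub>v n \<Longrightarrow> scalar_prod x (P *\<^sub>v x) > 0"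
    using P by (auto simp: strictly_positive_def)
  \<comment> \<open>\<open>c\<close> takes coordinates with respect to \<open>b\<close> and
    \<open>io\<close> is the isometric embedding, so \<open>io (c v)\<close> is the orthogonal
    projection of \<open>v\<close> onto the span of \<open>b\<close>.\<close>
  define c where "c v = Matrix.vec n (\<lambda>i. inner (b i) v)" for v
  define io where "io u = (\<Sum>i<n. vec_index u i *\<^sub>R b i)" for u
  have cc [simp]: "c v \<in> carrier_vec n" for v by (simp add: c_def)
  have Pcc [simp]: "P *\<^sub>v u \<in> carrier_vec n" if "u \<in> carrier_vec n" for u
    using Pc that by (rule mult_mat_vec_carrier)
  have c_add: "c (v + w) = c v + c w" for v w by (auto simp: c_def inner_add_right)
  have c_scale: "c (a *\<^sub>R v) = a \<cdot>\<^sub>v c v" for v a by (auto simp: c_def)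
  have c_diff: "c (v - w) = c v - c w" for v w by (auto simp: c_def inner_diff_right)
  have io_add: "io (u + w) = io u + io w" if "w \<in> carrier_vec n" for u w
    using that unfolding io_def sum.distrib[symmetric] by (intro sum.cong) (auto simp: scaleR_add_left)
  have io_scale: "io (a \<cdot>\<^sub>v u) = a *\<^sub>R io u" if "u \<in> carrier_vec n" for a u
    using that unfolding io_def scaleR_sum_right by (intro sum.cong) auto
  have inner_io: "inner v (io u) = scalar_prod (c v) u" if "u \<in> carrier_vec n" for u v
    using that by (auto simp: io_def c_def inner_sum_right scalar_prod_lessThan inner_commute intro!: sum.cong)
  have c_io: "c (io u) = u" if "u \<in> carrier_vec n" for u
  proof (rule eq_vecI)
    fix i assume "i < dim_vec u"
    then have i: "i < n" using that by simp
    have "inner (b i) (io u) = (\<Sum>j<n. if j = i then vec_index u j else 0)"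
      unfolding io_def inner_sum_right by (intro sum.cong) (auto simp: b i)
    then show "vec_index (c (io u)) i = vec_index u i" using i by (simp add: c_def)
  qed (use that in \<open>simp add: c_def\<close>)
  define T where "T v = io (P *\<^sub>v c v) + (v - io (c v))" for v
  have lin_pi: "linear (\<lambda>v. io (c v))"
    by (intro linearI) (auto simp: c_add c_scale io_add io_scale)
  have lin_T: "linear T"
    unfolding T_def
    by (intro linear_compose_add linear_compose_sub lin_pi linear_ident linearI)
       (auto simp: c_add c_scale io_add io_scale mult_add_distrib_mat_vec[OF Pc] mult_mat_vec[OF Pc])
  have bT: "blinfun_apply (Blinfun T) = T"
    using lin_T by (intro bounded_linear_Blinfun_apply) (simp add: linear_conv_bounded_linear)
  define Pi where "Pi = Blinfun (\<lambda>v. io (c v))"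
  have bPi: "blinfun_apply Pi = (\<lambda>v. io (c v))"
    unfolding Pi_def using lin_pi by (intro bounded_linear_Blinfun_apply) (simp add: linear_conv_bounded_linear)
  define M where "M = {X. (\<forall>x y. inner (blinfun_apply X x) y = inner x (X y)) \<and> (\<forall>x. X (Pi x) = Pi (X x))}"
  have inT: "inner v (T w) = scalar_prod (c v) (P *\<^sub>v c w) + inner v w - scalar_prod (c v) (c w)" for v w
    by (simp add: T_def inner_add_right inner_diff_right inner_io)
  have Tsa: "inner (T x) y = inner x (T y)" for x y
    using comm_scalar_prod[OF cc[of x] cc[of y]] comm_scalar_prod[OF cc[of y] Pcc[OF cc[of x]]]
      Psa[OF cc[of x] cc[of y]]
    unfolding inner_commute[of "T x" y] inT by (simp add: inner_commute[of y x])
  obtain R where R: "R \<in> M" "R o\<^sub>L R = Blinfun T" "\<And>x. x \<noteq> 0 \<Longrightarrow> inner x (R x) > 0"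
  proof (rule positive_operator_sqrt[of M "Blinfun T"])
    show "closed M" unfolding M_def
      by (intro closed_Collect_conj closed_Collect_all closed_Collect_eq continuous_intros)
    show "subspace M" unfolding M_def subspace_def
      by (auto simp: blinfun.add_left blinfun.scaleR_left blinfun.add_right blinfun.scaleR_right
          inner_add_left inner_add_right blinfun.zero_left blinfun.zero_right)
    show "id_blinfun \<in> M" by (simp add: M_def)
    show "X o\<^sub>L X \<in> M" if "X \<in> M" for X using that by (simp add: M_def)
    show "inner (X x) y = inner x (X y)" if "X \<in> M" for X x y using that by (simp add: M_def)
    have "c (T v) = P *\<^sub>v c v" for v
      unfolding T_def by (simp add: c_add c_diff c_io) (auto simp: c_def)
    moreover have "T (io (c v)) = io (P *\<^sub>v c v)" for v by (simp add: T_def c_io)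
    ultimately show "Blinfun T \<in> M" by (auto simp: M_def bT bPi Tsa)
    fix x :: 'v assume x: "x \<noteq> 0"
    \<comment> \<open>Bessel's inequality: the complement contributes
      \<open>inner x x - scalar_prod (c x) (c x)\<close> to \<open>inner x (T x)\<close>, which is
      nonnegative, and positive when \<open>c x\<close> vanishes.\<close>
    have "0 \<le> inner (x - io (c x)) (x - io (c x))" by simp
    also have "\<dots> = inner x x - scalar_prod (c x) (c x)"
      using inner_io[OF cc[of x], of x] inner_io[OF cc[of x], of "io (c x)"]
      by (simp add: inner_diff_left inner_diff_right c_io inner_commute)
    finally have 1: "scalar_prod (c x) (c x) \<le> inner x x" by simp
    show "inner x (Blinfun T x) > 0"
    proof (cases "c x = 0\<^sub>v n")
      case True
      then show ?thesis using x Pc by (simp add: bT inT)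
    next
      case False
      then show ?thesis using Ppos[OF cc False] 1 by (simp add: bT inT)
    qed
  qed blast
  \<comment> \<open>The matrix of \<open>R\<close> on the span of \<open>b\<close>. This span is
    invariant since \<open>R\<close> commutes with the projection, so the square of \<open>S\<close>
    is the matrix of \<open>T\<close> there, that is \<open>P\<close>.\<close>
  define S where "S = Matrix.mat n n (\<lambda>(i, j). inner (b i) (R (b j)))"
  have Sc: "S \<in> carrier_mat n n" by (simp add: S_def)
  have Sv: "S *\<^sub>v u = c (R (io u))" if "u \<in> carrier_vec n" for u
  proof (rule eq_vecI)
    fix i assume "i < dim_vec (c (R (io u)))"
    then have i: "i < n" by (simp add: c_def)
    show "vec_index (S *\<^sub>v u) i = vec_index (c (R (io u))) i"
      using i that by (auto simp: S_def c_def io_def blinfun.sum_right blinfun.scaleR_right inner_sum_right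
          scalar_prod_lessThan intro!: sum.cong)
  qed (simp add: S_def c_def)
  have Rsa: "inner (R x) y = inner x (R y)" and Rpi: "R (io (c x)) = io (c (R x))" for x y
    using R(1) by (auto simp: M_def bPi)
  have RR: "R (R x) = T x" for x using R(2) bT by (metis blinfun_apply_blinfun_compose)
  have "S * S = P"
  proof (rule eq_mat_mult_vecI[of _ n n])
    fix u :: "real Matrix.vec" assume u: "u \<in> carrier_vec n"
    have "(S * S) *\<^sub>v u = c (R (io (c (R (io u)))))"
      using u Sc by (simp add: assoc_mult_mat_vec[OF Sc Sc] Sv)
    also have "\<dots> = c (T (io u))" by (simp add: Rpi c_io RR)
    also have "\<dots> = P *\<^sub>v u" using u by (simp add: T_def c_io)
    finally show "(S * S) *\<^sub>v u = P *\<^sub>v u" .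
  qed (use Sc Pc in auto)
  moreover have "strictly_positive n S"
    unfolding strictly_positive_def
  proof (intro conjI ballI impI Sc)
    fix x y :: "real Matrix.vec" assume x: "x \<in> carrier_vec n" and y: "y \<in> carrier_vec n"
    have "scalar_prod (S *\<^sub>v x) y = inner (R (io x)) (io y)" using x y by (simp add: Sv inner_io)
    also have "\<dots> = inner (R (io y)) (io x)" by (metis Rsa inner_commute)
    also have "\<dots> = scalar_prod x (S *\<^sub>v y)" using x y comm_scalar_prod[OF x, of "c (R (io y))"] by (simp add: Sv inner_io)
    finally show "scalar_prod (S *\<^sub>v x) y = scalar_prod x (S *\<^sub>v y)" .
  next
    fix x :: "real Matrix.vec" assume x: "x \<in> carrier_vec n" "x \<noteq> 0\<^sub>v n"
    have "c 0 = 0\<^sub>v n" by (auto simp: c_def)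
    then have "io x \<noteq> 0" using c_io[OF x(1)] x(2) by auto
    then have "0 < inner (R (io x)) (io x)" using R(3) by (simp add: inner_commute)
    then show "scalar_prod x (S *\<^sub>v x) > 0" using x comm_scalar_prod[OF x(1), of "c (R (io x))"] by (simp add: Sv inner_io)
  qed
  ultimately show ?thesis using that by blast
qed

section \<open>Decomposable vectors\<close>

text \<open>The scalar is nonzero so that this is an equivalence relation, in which the zero vector
  is related only to itself.\<close>

definition parallel :: "real Matrix.vec \<Rightarrow> real Matrix.vec \<Rightarrow> bool" where
  "parallel u v \<longleftrightarrow> (\<exists>c. c \<noteq> 0 \<and> v = c \<cdot>\<^sub>v u)"

lemma parallel_refl [simp]: "parallel u u"
  unfolding parallel_def by (intro exI[of _ 1]) auto

lemma parallel_sym: "parallel u v \<Longrightarrow> parallel v u"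
  unfolding parallel_def
proof (elim exE conjE)
  fix c :: real assume "c \<noteq> 0" "v = c \<cdot>\<^sub>v u"
  then show "\<exists>c. c \<noteq> 0 \<and> u = c \<cdot>\<^sub>v v"
    by (intro exI[of _ "1 / c"]) (auto simp: smult_smult_assoc)
qed

lemma parallel_trans: "parallel u v \<Longrightarrow> parallel v w \<Longrightarrow> parallel u w"
  unfolding parallel_def
proof (elim exE conjE)
  fix c c' :: real assume "c \<noteq> 0" "v = c \<cdot>\<^sub>v u" "c' \<noteq> 0" "w = c' \<cdot>\<^sub>v v"
  then show "\<exists>c. c \<noteq> 0 \<and> w = c \<cdot>\<^sub>v u"
    by (intro exI[of _ "c' * c"]) (auto simp: smult_smult_assoc)
qed

text \<open>The component of \<open>u\<close> orthogonal to \<open>v\<close> works: its product with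
  \<open>u\<close> is its own squared length, which vanishes only if \<open>u\<close> is a multiple
  of \<open>v\<close>.\<close>

lemma ex_orthogonal_not_orthogonal:
  assumes u: "u \<in> carrier_vec n" "u \<noteq> 0\<^sub>v n" and v: "v \<in> carrier_vec n" "v \<noteq> 0\<^sub>v n"
    and np: "\<not> parallel u v"
  obtains a where "a \<in> carrier_vec n" "scalar_prod v a = 0" "scalar_prod u a \<noteq> 0"
proof -
  define t where "t = scalar_prod u v / scalar_prod v v"
  define a where "a = u - t \<cdot>\<^sub>v v"
  have a: "a \<in> carrier_vec n" using u v by (simp add: a_def)
  have vv: "scalar_prod v v \<noteq> 0" using scalar_prod_self_pos[OF v] by simp
  have va: "scalar_prod v a = 0"
    using u v vv by (simp add: a_def t_def scalar_prod_minus_distrib[of v n u] comm_scalar_prod[OF v(1) u(1)])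
  have "scalar_prod u a \<noteq> 0"
  proof
    assume "scalar_prod u a = 0"
    then have "scalar_prod a a = 0"
      using u v a va unfolding a_def
      by (simp add: minus_scalar_prod_distrib[of u n "t \<cdot>\<^sub>v v" "u - t \<cdot>\<^sub>v v"])
    then have "a = 0\<^sub>v n" using a scalar_prod_self_eq_0_iff by blast
    then have "vec_index (u - t \<cdot>\<^sub>v v) i = 0" if "i < n" for i
      using that by (simp add: a_def[symmetric])
    then have ut: "u = t \<cdot>\<^sub>v v"
      using u v by (intro eq_vecI) auto
    have "t \<noteq> 0"
    proof
      assume "t = 0"
      then have "u = 0\<^sub>v n" using ut u(1) v(1) by (intro eq_vecI) auto
      then show False using u(2) by simp
    qed
    then show False using ut np parallel_sym unfolding parallel_def by blast
  qed
  then show ?thesis using that a va by blast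
qed

text \<open>Either \<open>u\<close> itself works, or \<open>u\<close> and \<open>v\<close> are
  orthogonal and \<open>u + v\<close> does.\<close>

lemma ex_not_orthogonal_both:
  assumes u: "u \<in> carrier_vec n" "u \<noteq> 0\<^sub>v n" and v: "v \<in> carrier_vec n" "v \<noteq> 0\<^sub>v n"
  shows "\<exists>w\<in>carrier_vec n. scalar_prod u w \<noteq> 0 \<and> scalar_prod v w \<noteq> (0::real)"
proof (cases "scalar_prod u v = 0")
  case True
  then have "scalar_prod v u = 0" using comm_scalar_prod[OF u(1) v(1)] by simp
  then have "scalar_prod u (u + v) = scalar_prod u u" "scalar_prod v (u + v) = scalar_prod v v"
    using True u v by (simp_all add: scalar_prod_add_distrib[of _ n])
  then show ?thesis using scalar_prod_self_pos[OF u] scalar_prod_self_pos[OF v] u v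
    by (intro bexI[of _ "u + v"]) auto
next
  case False
  then have "scalar_prod v u \<noteq> 0" using comm_scalar_prod[OF u(1) v(1)] by simp
  then show ?thesis using scalar_prod_self_pos[OF u] u by (intro bexI[of _ u]) auto
qed

text \<open>Two distinct unit vectors cannot both be parallel to \<open>u\<close>, since they are
  not parallel to each other.\<close>

lemma ex_not_parallel:
  assumes n: "n \<ge> 2" and u: "u \<in> carrier_vec n"
  obtains v where "v \<in> carrier_vec n" "v \<noteq> 0\<^sub>v n" "\<not> parallel u v"
proof -
  have "\<not> parallel u (unit_vec n 0) \<or> \<not> parallel u (unit_vec n 1)"
  proof (rule ccontr)
    assume "\<not> ?thesis"
    then have "parallel (unit_vec n 0) (unit_vec n 1)" using parallel_sym parallel_trans by blast
    then obtain c :: real where "unit_vec n 1 = c \<cdot>\<^sub>v unit_vec n 0" by (auto simp: parallel_def)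
    then have "vec_index (unit_vec n 1) 1 = vec_index (c \<cdot>\<^sub>v unit_vec n 0) 1" by simp
    then show False using n by simp
  qed
  moreover have "unit_vec n 0 \<noteq> (0\<^sub>v n :: real Matrix.vec)" "unit_vec n 1 \<noteq> (0\<^sub>v n :: real Matrix.vec)"
    using n by auto
  ultimately show ?thesis using that unit_vec_carrier by blast
qed

lemma linear_functional_vec:
  fixes f :: "real Matrix.vec \<Rightarrow> real"
  assumes add: "\<And>u v. u \<in> carrier_vec n \<Longrightarrow> v \<in> carrier_vec n \<Longrightarrow> f (u + v) = f u + f v"
    and scale: "\<And>c u. u \<in> carrier_vec n \<Longrightarrow> f (c \<cdot>\<^sub>v u) = c * f u"
    and u: "u \<in> carrier_vec n"
  shows "f u = (\<Sum>i<n. f (unit_vec n i) * vec_index u i)"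
proof -
  \<comment> \<open>Truncations of \<open>u\<close>, along which its coordinates are added one at a
    time.\<close>
  define w where "w k = Matrix.vec n (\<lambda>i. if i < k then vec_index u i else 0)" for k
  have w: "w k \<in> carrier_vec n" for k by (simp add: w_def)
  have "f (w k) = (\<Sum>i<k. f (unit_vec n i) * vec_index u i)" if "k \<le> n" for k
    using that
  proof (induction k)
    case 0
    have "w 0 = 0 \<cdot>\<^sub>v w 0" by (auto simp: w_def)
    then show ?case using scale[OF w[of 0], of 0] by simp
  next
    case (Suc k)
    have "w (Suc k) = w k + vec_index u k \<cdot>\<^sub>v unit_vec n k"
      using Suc.prems by (intro eq_vecI) (auto simp: w_def less_Suc_eq)
    then show ?case using Suc w by (simp add: add scale)
  qed
  moreover have "w n = u" using u by (auto simp: w_def)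
  ultimately show ?thesis by auto
qed

locale tensor_space =
  fixes l :: nat and d :: "nat \<Rightarrow> nat"
    and tensor :: "(nat \<Rightarrow> real Matrix.vec) \<Rightarrow> 'v::euclidean_space"
  assumes tensor_product: "euclidean_tensor_product l d tensor"
begin

abbreviation F where "F \<equiv> vec_families l d"

text \<open>By \<open>tensor_eq_0_iff\<close> these are the families whose tensor is nonzero; such a
  tensor determines its factors up to scaling.\<close>

definition nonzero_families where
  "nonzero_families = {x \<in> F. \<forall>i\<in>{1..l}. x i \<noteq> 0\<^sub>v (d i)}"

abbreviation N where "N \<equiv> nonzero_families"

text \<open>The support of a Hamming distance between families up to scaling of factors. For nonzero
  families it is empty exactly if the tensors are proportional.\<close>

definition differ :: "(nat \<Rightarrow> real Matrix.vec) \<Rightarrow> (nat \<Rightarrow> real Matrix.vec) \<Rightarrow> nat set" where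
  "differ x y = {i\<in>{1..l}. \<not> parallel (x i) (y i)}"

lemma familiesD: "x \<in> F \<Longrightarrow> i \<in> {1..l} \<Longrightarrow> x i \<in> carrier_vec (d i)"
  by (simp add: vec_families_def)

lemma families_upd: "x \<in> F \<Longrightarrow> (i \<in> {1..l} \<Longrightarrow> u \<in> carrier_vec (d i)) \<Longrightarrow> x(i := u) \<in> F"
  by (auto simp: vec_families_def)

lemma nonzeroD:
  assumes "x \<in> N"
  shows "x \<in> F" "i \<in> {1..l} \<Longrightarrow> x i \<in> carrier_vec (d i)" "i \<in> {1..l} \<Longrightarrow> x i \<noteq> 0\<^sub>v (d i)"
  using assms by (auto simp: nonzero_families_def vec_families_def)

lemma nonzero_upd: "x \<in> N \<Longrightarrow> u \<in> carrier_vec (d i) \<Longrightarrow> u \<noteq> 0\<^sub>v (d i) \<Longrightarrow> x(i := u) \<in> N"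
  by (auto simp: nonzero_families_def vec_families_def)

lemma tensor_add:
  "x \<in> F \<Longrightarrow> i \<in> {1..l} \<Longrightarrow> u \<in> carrier_vec (d i) \<Longrightarrow> v \<in> carrier_vec (d i) \<Longrightarrow>
     tensor (x(i := u + v)) = tensor (x(i := u)) + tensor (x(i := v))"
  and tensor_smult:
  "x \<in> F \<Longrightarrow> i \<in> {1..l} \<Longrightarrow> u \<in> carrier_vec (d i) \<Longrightarrow> tensor (x(i := c \<cdot>\<^sub>v u)) = c *\<^sub>R tensor (x(i := u))"
  and span_tensor: "span (tensor ` F) = UNIV"
  and inner_tensor:
  "x \<in> F \<Longrightarrow> y \<in> F \<Longrightarrow> inner (tensor x) (tensor y) = (\<Prod>i\<in>{1..l}. scalar_prod (x i) (y i))"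
  using tensor_product by (auto simp: euclidean_tensor_product_def)

text \<open>The decomposable vectors span, so \<open>v - w\<close> is orthogonal to itself.\<close>

lemma tensor_ext:
  assumes "\<And>y. y \<in> F \<Longrightarrow> inner v (tensor y) = inner w (tensor y)"
  shows "v = w"
proof -
  have "inner (v - w) z = 0" if "z \<in> span (tensor ` F)" for z
    using that by (induction rule: span_induct_alt) (use assms in \<open>auto simp: inner_diff_left inner_add_right\<close>)
  then have "inner (v - w) (v - w) = 0" using span_tensor by auto
  then show ?thesis by simp
qed

lemma linear_eq_on_tensors:
  assumes "linear f" "linear g" "\<And>x. x \<in> F \<Longrightarrow> f (tensor x) = g (tensor x)"
  shows "f = g"
  using linear_eq_on_span[OF assms(1,2), of "tensor ` F"] assms(3) span_tensor by auto

lemma tensor_cong: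
  assumes "x \<in> F" "\<And>i. i \<in> {1..l} \<Longrightarrow> x i = y i"
  shows "tensor x = tensor y"
proof -
  have "y \<in> F" using assms by (auto simp: vec_families_def)
  then show ?thesis using assms by (intro tensor_ext) (auto simp: inner_tensor)
qed

lemma tensor_smult_all:
  assumes "x \<in> F"
  shows "tensor (\<lambda>i. c i \<cdot>\<^sub>v x i) = (\<Prod>i\<in>{1..l}. c i) *\<^sub>R tensor x"
proof (rule tensor_ext)
  fix y assume y: "y \<in> F"
  have "(\<lambda>i. c i \<cdot>\<^sub>v x i) \<in> F" using assms by (auto simp: vec_families_def)
  then have "inner (tensor (\<lambda>i. c i \<cdot>\<^sub>v x i)) (tensor y) = (\<Prod>i\<in>{1..l}. scalar_prod (c i \<cdot>\<^sub>v x i) (y i))"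
    using y by (rule inner_tensor)
  also have "\<dots> = (\<Prod>i\<in>{1..l}. c i * scalar_prod (x i) (y i))"
    using familiesD[OF assms] familiesD[OF y] by (intro prod.cong) (auto intro!: smult_scalar_prod_distrib)
  also have "\<dots> = inner ((\<Prod>i\<in>{1..l}. c i) *\<^sub>R tensor x) (tensor y)"
    by (simp add: inner_tensor assms y prod.distrib)
  finally show "inner (tensor (\<lambda>i. c i \<cdot>\<^sub>v x i)) (tensor y) = inner ((\<Prod>i\<in>{1..l}. c i) *\<^sub>R tensor x) (tensor y)" .
qed

lemma inner_tensor_upd:
  assumes "x \<in> F" "y \<in> F" "i \<in> {1..l}" "u \<in> carrier_vec (d i)"
  shows "inner (tensor (x(i := u))) (tensor y) = scalar_prod u (y i) * (\<Prod>k\<in>{1..l}-{i}. scalar_prod (x k) (y k))"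
proof -
  have "inner (tensor (x(i := u))) (tensor y) = (\<Prod>k\<in>{1..l}. scalar_prod ((x(i := u)) k) (y k))"
    using assms by (intro inner_tensor families_upd) auto
  also have "\<dots> = scalar_prod u (y i) * (\<Prod>k\<in>{1..l}-{i}. scalar_prod ((x(i := u)) k) (y k))"
    using assms by (subst prod.remove[of _ i]) auto
  also have "(\<Prod>k\<in>{1..l}-{i}. scalar_prod ((x(i := u)) k) (y k)) = (\<Prod>k\<in>{1..l}-{i}. scalar_prod (x k) (y k))"
    by (intro prod.cong) auto
  finally show ?thesis .
qed

lemma tensor_eq_0_iff:
  assumes "x \<in> F"
  shows "tensor x = 0 \<longleftrightarrow> x \<notin> N"
proof -
  have "tensor x = 0 \<longleftrightarrow> (\<Prod>i\<in>{1..l}. scalar_prod (x i) (x i)) = 0"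
    using inner_tensor[OF assms assms] by (metis inner_eq_zero_iff)
  also have "\<dots> \<longleftrightarrow> (\<exists>i\<in>{1..l}. scalar_prod (x i) (x i) = 0)" by simp
  also have "\<dots> \<longleftrightarrow> (\<exists>i\<in>{1..l}. x i = 0\<^sub>v (d i))"
    by (intro bex_cong refl scalar_prod_self_eq_0_iff familiesD[OF assms])
  also have "\<dots> \<longleftrightarrow> x \<notin> N" using assms by (auto simp: nonzero_families_def)
  finally show ?thesis .
qed

lemma differ_sym: "differ x y = differ y x"
  unfolding differ_def using parallel_sym by blast

text \<open>Transitivity of \<open>parallel\<close> in a fixed slot, in the form used for chasing
  differing slots along paths of families.\<close>

lemma differ_cong: "j \<notin> differ x y \<Longrightarrow> j \<in> differ x z \<longleftrightarrow> j \<in> differ y z"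
  unfolding differ_def using parallel_sym parallel_trans by blast

lemma differ_subset: "differ x y \<subseteq> {1..l}" by (auto simp: differ_def)

lemma differ_upd_self: "differ x (x(i := u)) \<subseteq> {i}" by (auto simp: differ_def)

lemma differ_upd_self_eq: "i \<in> {1..l} \<Longrightarrow> \<not> parallel (x i) u \<Longrightarrow> differ x (x(i := u)) = {i}"
  by (auto simp: differ_def)

lemma differ_upd_restore: "differ x (y(i := x i)) = differ x y - {i}" by (auto simp: differ_def)

lemma differ_upd_upd: "differ (x(i := u)) (y(i := u)) = differ x y - {i}" by (auto simp: differ_def)

text \<open>Testing against families that vary in two differing slots gives a diagonal \<open>2 \<times> 2\<close> matrix with
  nonzero diagonal, whereas a decomposable vector yields a matrix of rank at most one.\<close>

lemma decomposable_sum_differ: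
  assumes p: "p \<in> N" and q: "q \<in> N" and z: "z \<in> F" and eq: "tensor p + tensor q = tensor z"
    and i: "i \<in> differ p q" and j: "j \<in> differ p q"
  shows "i = j"
proof (rule ccontr)
  assume ij: "i \<noteq> j"
  have iI: "i \<in> {1..l}" and jI: "j \<in> {1..l}" using i j by (auto simp: differ_def)
  \<comment> \<open>\<open>w\<close> fills the slots other than \<open>i\<close> and
    \<open>j\<close>, so that their contribution \<open>G\<close> is nonzero for both
    \<open>p\<close> and \<open>q\<close>.\<close>
  have "\<forall>k\<in>{1..l}. \<exists>w\<in>carrier_vec (d k). scalar_prod (p k) w \<noteq> 0 \<and> scalar_prod (q k) w \<noteq> 0"
    using ex_not_orthogonal_both nonzeroD[OF p] nonzeroD[OF q] by blast
  then obtain w where w: "\<And>k. k \<in> {1..l} \<Longrightarrow> w k \<in> carrier_vec (d k)"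
      "\<And>k. k \<in> {1..l} \<Longrightarrow> scalar_prod (p k) (w k) \<noteq> 0" "\<And>k. k \<in> {1..l} \<Longrightarrow> scalar_prod (q k) (w k) \<noteq> 0"
    by metis
  \<comment> \<open>In a slot where \<open>p\<close> and \<open>q\<close> differ, each of the two
    factors can be detected without the other; this makes the test matrix diagonal.\<close>
  have dual: "\<exists>a\<in>carrier_vec (d k). \<exists>b\<in>carrier_vec (d k). scalar_prod (q k) a = 0 \<and> scalar_prod (p k) a \<noteq> 0
      \<and> scalar_prod (p k) b = 0 \<and> scalar_prod (q k) b \<noteq> 0" if k: "k \<in> differ p q" for k
  proof -
    have kI: "k \<in> {1..l}" and np: "\<not> parallel (p k) (q k)" "\<not> parallel (q k) (p k)"
      using k parallel_sym by (auto simp: differ_def)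
    note pk = nonzeroD(2,3)[OF p kI] and qk = nonzeroD(2,3)[OF q kI]
    obtain a where "a \<in> carrier_vec (d k)" "scalar_prod (q k) a = 0" "scalar_prod (p k) a \<noteq> 0"
      using ex_orthogonal_not_orthogonal[OF pk qk np(1)] .
    moreover obtain b where "b \<in> carrier_vec (d k)" "scalar_prod (p k) b = 0" "scalar_prod (q k) b \<noteq> 0"
      using ex_orthogonal_not_orthogonal[OF qk pk np(2)] .
    ultimately show ?thesis by blast
  qed
  obtain a1 a2 where a: "a1 \<in> carrier_vec (d i)" "a2 \<in> carrier_vec (d i)" "scalar_prod (q i) a1 = 0"
      "scalar_prod (p i) a1 \<noteq> 0" "scalar_prod (p i) a2 = 0" "scalar_prod (q i) a2 \<noteq> 0"
    using dual[OF i] by blast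
  obtain b1 b2 where b: "b1 \<in> carrier_vec (d j)" "b2 \<in> carrier_vec (d j)" "scalar_prod (q j) b1 = 0"
      "scalar_prod (p j) b1 \<noteq> 0" "scalar_prod (p j) b2 = 0" "scalar_prod (q j) b2 \<noteq> 0"
    using dual[OF j] by blast
  define G where "G x = (\<Prod>k\<in>{1..l}-{i}-{j}. scalar_prod (x k) (w k))" for x
  have G: "inner (tensor x) (tensor (w(i := a, j := b))) = scalar_prod (x i) a * (scalar_prod (x j) b * G x)"
    if x: "x \<in> F" and a: "a \<in> carrier_vec (d i)" and b: "b \<in> carrier_vec (d j)" for x a b
  proof -
    have "w(i := a, j := b) \<in> F" using w(1) a b by (auto simp: vec_families_def)
    then have "inner (tensor x) (tensor (w(i := a, j := b))) = (\<Prod>k\<in>{1..l}. scalar_prod (x k) ((w(i := a, j := b)) k))"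
      using x by (intro inner_tensor)
    also have "\<dots> = scalar_prod (x i) a * (scalar_prod (x j) b * (\<Prod>k\<in>{1..l}-{i}-{j}. scalar_prod (x k) ((w(i := a, j := b)) k)))"
      using iI jI ij by (subst prod.remove[of _ i], simp, simp, subst prod.remove[of _ j]) auto
    also have "(\<Prod>k\<in>{1..l}-{i}-{j}. scalar_prod (x k) ((w(i := a, j := b)) k)) = G x"
      unfolding G_def by (intro prod.cong) auto
    finally show ?thesis .
  qed
  have Gp: "G p \<noteq> 0" "G q \<noteq> 0" using w by (auto simp: G_def)
  have pF: "p \<in> F" and qF: "q \<in> F" using p q nonzeroD(1) by auto
  have E: "scalar_prod (p i) a * (scalar_prod (p j) b * G p) + scalar_prod (q i) a * (scalar_prod (q j) b * G q)
      = scalar_prod (z i) a * (scalar_prod (z j) b * G z)"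
    if "a \<in> carrier_vec (d i)" "b \<in> carrier_vec (d j)" for a b
    using G[OF pF that] G[OF qF that] G[OF z that] by (simp add: eq[symmetric] inner_add_left)
  have "(scalar_prod (p i) a1 * (scalar_prod (p j) b1 * G p)) * (scalar_prod (q i) a2 * (scalar_prod (q j) b2 * G q))
      = (scalar_prod (z i) a1 * (scalar_prod (z j) b1 * G z)) * (scalar_prod (z i) a2 * (scalar_prod (z j) b2 * G z))"
    using E[of a1 b1] E[of a2 b2] a b by simp
  also have "\<dots> = (scalar_prod (z i) a1 * (scalar_prod (z j) b2 * G z)) * (scalar_prod (z i) a2 * (scalar_prod (z j) b1 * G z))"
    by (simp add: algebra_simps)
  also have "\<dots> = 0" using E[of a1 b2] E[of a2 b1] a b by simp
  finally show False using a b Gp by simp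
qed

text \<open>The scalars of all other slots multiply up and are absorbed into slot \<open>j\<close>,
  so the two tensors can be added within that single factor.\<close>

lemma tensor_differ_subset:
  assumes p: "p \<in> N" and q: "q \<in> N" and j: "j \<in> {1..l}" and sub: "differ p q \<subseteq> {j}"
  obtains c where "c \<noteq> 0" "tensor q = tensor (p(j := c \<cdot>\<^sub>v q j))"
proof -
  have "\<forall>k\<in>{1..l}-{j}. \<exists>c. c \<noteq> 0 \<and> q k = c \<cdot>\<^sub>v p k"
    using sub by (auto simp: differ_def parallel_def)
  then obtain c where c: "\<And>k. k \<in> {1..l}-{j} \<Longrightarrow> c k \<noteq> 0 \<and> q k = c k \<cdot>\<^sub>v p k" by metis
  define C where "C = (\<Prod>k\<in>{1..l}-{j}. c k)"
  have qj: "q j \<in> carrier_vec (d j)" using nonzeroD[OF q] j by blast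
  have pF: "p(j := q j) \<in> F" using nonzeroD(1)[OF p] qj by (auto intro: families_upd)
  have "tensor q = tensor (\<lambda>i. (c(j := 1)) i \<cdot>\<^sub>v (p(j := q j)) i)"
    using nonzeroD(1)[OF q] c by (intro tensor_cong) auto
  also have "\<dots> = (\<Prod>i\<in>{1..l}. (c(j := 1)) i) *\<^sub>R tensor (p(j := q j))"
    by (rule tensor_smult_all[OF pF])
  also have "(\<Prod>i\<in>{1..l}. (c(j := 1)) i) = C"
    using j unfolding C_def by (subst prod.remove[of _ j]) (auto intro!: prod.cong)
  also have "C *\<^sub>R tensor (p(j := q j)) = tensor (p(j := C \<cdot>\<^sub>v q j))"
    using nonzeroD(1)[OF p] j qj by (simp add: tensor_smult)
  finally show ?thesis using that[of C] c by (auto simp: C_def)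
qed

lemma tensor_differ_empty:
  assumes p: "p \<in> N" and q: "q \<in> N" and e: "differ p q = {}"
  obtains c where "c \<noteq> 0" "tensor q = c *\<^sub>R tensor p"
proof -
  have "\<forall>k\<in>{1..l}. \<exists>c. c \<noteq> 0 \<and> q k = c \<cdot>\<^sub>v p k"
    using e by (auto simp: differ_def parallel_def)
  then obtain c where c: "\<And>k. k \<in> {1..l} \<Longrightarrow> c k \<noteq> 0 \<and> q k = c k \<cdot>\<^sub>v p k" by metis
  have "tensor q = tensor (\<lambda>i. c i \<cdot>\<^sub>v p i)"
    using nonzeroD(1)[OF q] c by (intro tensor_cong) auto
  also have "\<dots> = (\<Prod>i\<in>{1..l}. c i) *\<^sub>R tensor p"
    by (rule tensor_smult_all[OF nonzeroD(1)[OF p]])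
  finally show ?thesis using that[of "\<Prod>i\<in>{1..l}. c i"] c by auto
qed

text \<open>In a slot where they differ, replacing the factor of \<open>y\<close> by a vector
  orthogonal to that of \<open>x\<close> but not to that of \<open>y\<close> gives a decomposable
  vector orthogonal to the tensor of \<open>x\<close> but not to that of \<open>y\<close>.\<close>

lemma proportional_tensors:
  assumes x: "x \<in> N" and y: "y \<in> N" and eq: "tensor y = c *\<^sub>R tensor x"
  shows "differ x y = {}"
proof (rule ccontr)
  assume "differ x y \<noteq> {}"
  then obtain j where j: "j \<in> {1..l}" "\<not> parallel (y j) (x j)" using parallel_sym by (auto simp: differ_def)
  obtain a where a: "a \<in> carrier_vec (d j)" "scalar_prod (x j) a = 0" "scalar_prod (y j) a \<noteq> 0"
    using ex_orthogonal_not_orthogonal[OF nonzeroD(2,3)[OF y j(1)] nonzeroD(2,3)[OF x j(1)] j(2)] .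
  have yF: "y(j := a) \<in> F" using nonzeroD(1)[OF y] a by (auto intro: families_upd)
  have "inner (tensor x) (tensor (y(j := a))) = 0"
    using a j by (auto simp: inner_tensor[OF nonzeroD(1)[OF x] yF] intro!: bexI[of _ j])
  then have "inner (tensor y) (tensor (y(j := a))) = 0" by (simp add: eq)
  moreover have "inner (tensor y) (tensor (y(j := a))) \<noteq> 0"
    using a j scalar_prod_self_pos[OF nonzeroD(2,3)[OF y]]
    by (auto simp: inner_tensor[OF nonzeroD(1)[OF y] yF] less_imp_neq[symmetric])
  ultimately show False by simp
qed

text \<open>The difference of the two tensors has \<open>u - v\<close> in slot \<open>i\<close>, and
  a tensor vanishes only if one of its factors does.\<close>

lemma tensor_upd_inj:
  assumes x: "x \<in> N" and i: "i \<in> {1..l}" and u: "u \<in> carrier_vec (d i)" and v: "v \<in> carrier_vec (d i)"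
    and eq: "tensor (x(i := u)) = tensor (x(i := v))"
  shows "u = v"
proof -
  have xF: "x \<in> F" using x by (rule nonzeroD)
  have "u - v = u + (-1) \<cdot>\<^sub>v v" using u v by auto
  then have "tensor (x(i := u - v)) = 0"
    using eq u v xF i by (simp add: tensor_add tensor_smult)
  moreover have "x(i := u - v) \<in> F" using xF u v by (auto intro: families_upd)
  ultimately have "x(i := u - v) \<notin> N" by (simp add: tensor_eq_0_iff)
  then have "u - v = 0\<^sub>v (d i)" using nonzero_upd[OF x, of "u - v" i] u v by auto
  then have "vec_index (u - v) k = 0" if "k < d i" for k using that by simp
  then show ?thesis using u v by (intro eq_vecI) auto
qed

section \<open>Tensor products of linear maps\<close>

abbreviation "tensor_of_maps \<equiv> is_tensor_of_maps l d tensor"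
abbreviation "GL \<equiv> GL_tensor l d tensor"
abbreviation "A \<equiv> positive_tensors l d tensor"
abbreviation "O' \<equiv> O_tensor l d tensor"

lemma blinfun_eq_on_tensors:
  assumes "\<And>x. x \<in> F \<Longrightarrow> blinfun_apply X (tensor x) = Y (tensor x)" and "linear Y"
  shows "blinfun_apply X = Y"
  using assms by (intro linear_eq_on_tensors) (auto simp: linear_blinfun)

lemma maps_families:
  assumes "\<And>i. i \<in> {1..l} \<Longrightarrow> S i \<in> carrier_mat (d i) (d i)" and "x \<in> F"
  shows "(\<lambda>i. S i *\<^sub>v x i) \<in> F"
proof -
  have "S i *\<^sub>v x i \<in> carrier_vec (d i)" if "i \<in> {1..l}" for i
    by (rule mult_mat_vec_carrier[OF assms(1)[OF that] familiesD[OF assms(2) that]])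
  then show ?thesis by (simp add: vec_families_def)
qed

lemma ex_tensor_of_maps:
  assumes "\<And>i. i \<in> {1..l} \<Longrightarrow> S i \<in> carrier_mat (d i) (d i)"
  obtains X where "tensor_of_maps S X"
  using ex1_is_tensor_of_maps[OF tensor_product, of S] assms by blast

lemma tensor_of_maps_compose:
  assumes S: "\<And>i. i \<in> {1..l} \<Longrightarrow> S i \<in> carrier_mat (d i) (d i)"
    and R: "\<And>i. i \<in> {1..l} \<Longrightarrow> R i \<in> carrier_mat (d i) (d i)"
    and X: "tensor_of_maps S X" and Y: "tensor_of_maps R Y"
  shows "tensor_of_maps (\<lambda>i. S i * R i) (X o\<^sub>L Y)"
  unfolding is_tensor_of_maps_def
proof
  fix x assume x: "x \<in> F"
  have Rx: "(\<lambda>i. R i *\<^sub>v x i) \<in> F" by (rule maps_families[OF R x])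
  have "(X o\<^sub>L Y) (tensor x) = tensor (\<lambda>i. S i *\<^sub>v (R i *\<^sub>v x i))"
    using x Rx X Y by (simp add: is_tensor_of_maps_def)
  also have "\<dots> = tensor (\<lambda>i. (S i * R i) *\<^sub>v x i)"
  proof (rule tensor_cong)
    show "(\<lambda>i. S i *\<^sub>v (R i *\<^sub>v x i)) \<in> F" by (rule maps_families[OF S Rx])
    show "S i *\<^sub>v (R i *\<^sub>v x i) = (S i * R i) *\<^sub>v x i" if "i \<in> {1..l}" for i
      using assoc_mult_mat_vec[OF S[OF that] R[OF that] familiesD[OF x that]] by simp
  qed
  finally show "(X o\<^sub>L Y) (tensor x) = tensor (\<lambda>i. (S i * R i) *\<^sub>v x i)" .
qed

lemma tensor_of_maps_unique:
  assumes S: "\<And>i. i \<in> {1..l} \<Longrightarrow> S i \<in> carrier_mat (d i) (d i)"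
    and eq: "\<And>i. i \<in> {1..l} \<Longrightarrow> S i = R i" and X: "tensor_of_maps S X" and Y: "tensor_of_maps R Y"
  shows "X = Y"
proof -
  have "X (tensor x) = Y (tensor x)" if x: "x \<in> F" for x
  proof -
    have "(\<lambda>i. S i *\<^sub>v x i) \<in> F" by (rule maps_families[OF S x])
    then have "tensor (\<lambda>i. S i *\<^sub>v x i) = tensor (\<lambda>i. R i *\<^sub>v x i)" by (rule tensor_cong) (simp add: eq)
    then show ?thesis using X Y x by (simp add: is_tensor_of_maps_def)
  qed
  then have "blinfun_apply X = blinfun_apply Y" by (rule blinfun_eq_on_tensors) (auto simp: linear_blinfun)
  then show ?thesis by (simp add: blinfun_apply_inject)
qed

lemma tensor_of_maps_one: "tensor_of_maps (\<lambda>i. 1\<^sub>m (d i)) id_blinfun"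
  unfolding is_tensor_of_maps_def
proof
  fix x assume x: "x \<in> F"
  show "id_blinfun (tensor x) = tensor (\<lambda>i. 1\<^sub>m (d i) *\<^sub>v x i)"
    using tensor_cong[OF x, of "\<lambda>i. 1\<^sub>m (d i) *\<^sub>v x i"] familiesD[OF x] by simp
qed

text \<open>On decomposable vectors this holds slot by slot; linearity extends it to one argument
  after the other.\<close>

lemma tensor_of_maps_self_adjoint:
  assumes S: "\<And>i. i \<in> {1..l} \<Longrightarrow> strictly_positive (d i) (S i)" and X: "tensor_of_maps S X"
  shows "inner (X v) w = inner v (X w)"
proof -
  have carrier: "(\<lambda>i. S i *\<^sub>v x i) \<in> F" if "x \<in> F" for x
    using S by (intro maps_families that) (simp add: strictly_positive_def)
  have "inner (X (tensor x)) (tensor y) = inner (tensor x) (X (tensor y))" if x: "x \<in> F" and y: "y \<in> F" for x y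
  proof -
    have "scalar_prod (S i *\<^sub>v x i) (y i) = scalar_prod (x i) (S i *\<^sub>v y i)" if "i \<in> {1..l}" for i
      using S[OF that] familiesD[OF x that] familiesD[OF y that] by (simp add: strictly_positive_def)
    then show ?thesis
      using X x y by (auto simp: is_tensor_of_maps_def inner_tensor carrier intro!: prod.cong)
  qed
  then have "(\<lambda>v. inner (X v) (tensor y)) = (\<lambda>v. inner v (X (tensor y)))" if "y \<in> F" for y
    by (intro linear_eq_on_tensors)
       (use that in \<open>auto intro!: linearI simp: blinfun.add_right blinfun.scaleR_right inner_add_left\<close>)
  then have "(\<lambda>w. inner (X v) w) = (\<lambda>w. inner v (X w))" for v
    by (intro linear_eq_on_tensors)
       (auto intro!: linearI simp: blinfun.add_right blinfun.scaleR_right inner_add_right dest: fun_cong)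
  then show ?thesis by (rule fun_cong)
qed

lemma tensor_of_maps_image:
  assumes S: "\<And>i. i \<in> {1..l} \<Longrightarrow> S i \<in> carrier_mat (d i) (d i)" and X: "tensor_of_maps S X"
  shows "X ` tensor ` F \<subseteq> tensor ` F"
proof -
  have "X (tensor x) \<in> tensor ` F" if x: "x \<in> F" for x
    using X x maps_families[OF S x] by (simp add: is_tensor_of_maps_def)
  then show ?thesis by blast
qed

lemma positive_tensorsE:
  assumes "X \<in> A"
  obtains S where "\<And>i. i \<in> {1..l} \<Longrightarrow> strictly_positive (d i) (S i)"
    "\<And>i. i \<in> {1..l} \<Longrightarrow> S i \<in> carrier_mat (d i) (d i)" "tensor_of_maps S X"
  using assms unfolding positive_tensors_def strictly_positive_def mem_Collect_eq by blast

lemma positive_tensorsI: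
  assumes "\<And>i. i \<in> {1..l} \<Longrightarrow> strictly_positive (d i) (S i)" "tensor_of_maps S X"
  shows "X \<in> A"
  using assms strictly_positive_invertible_mat unfolding positive_tensors_def by blast

lemma positive_tensors_self_adjoint:
  assumes "X \<in> A" shows "inner (X v) w = inner v (X w)"
  using positive_tensorsE[OF assms] tensor_of_maps_self_adjoint by metis

text \<open>The inverse is the tensor product of the slotwise inverses, so it preserves decomposable
  vectors too. This later puts the orthogonal factor into \<open>GL\<close>.\<close>

lemma positive_tensors_inverse:
  assumes "X \<in> A"
  obtains Y where "X o\<^sub>L Y = id_blinfun" "Y o\<^sub>L X = id_blinfun" "Y \<in> GL" "X \<in> GL"
proof -
  obtain S where S: "\<And>i. i \<in> {1..l} \<Longrightarrow> strictly_positive (d i) (S i)"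
    "\<And>i. i \<in> {1..l} \<Longrightarrow> S i \<in> carrier_mat (d i) (d i)" "tensor_of_maps S X"
    using positive_tensorsE[OF assms] by metis
  have "\<exists>B. B \<in> carrier_mat (d i) (d i) \<and> S i * B = 1\<^sub>m (d i) \<and> B * S i = 1\<^sub>m (d i)" if "i \<in> {1..l}" for i
    using strictly_positive_inverse[OF S(1)[OF that]] by metis
  then obtain B where B: "\<And>i. i \<in> {1..l} \<Longrightarrow> B i \<in> carrier_mat (d i) (d i)"
    "\<And>i. i \<in> {1..l} \<Longrightarrow> S i * B i = 1\<^sub>m (d i)" "\<And>i. i \<in> {1..l} \<Longrightarrow> B i * S i = 1\<^sub>m (d i)" by metis
  obtain Y where Y: "tensor_of_maps B Y" using ex_tensor_of_maps[of B] B(1) by metis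
  have XY: "X o\<^sub>L Y = id_blinfun"
    by (rule tensor_of_maps_unique[OF _ _ tensor_of_maps_compose[OF S(2) B(1) S(3) Y] tensor_of_maps_one])
       (use S B in auto)
  have YX: "Y o\<^sub>L X = id_blinfun"
    by (rule tensor_of_maps_unique[OF _ _ tensor_of_maps_compose[OF B(1) S(2) Y S(3)] tensor_of_maps_one])
       (use S B in auto)
  show ?thesis using that[OF XY YX] bij_blinfunI[OF XY YX] bij_blinfunI[OF YX XY]
      tensor_of_maps_image[OF S(2,3)] tensor_of_maps_image[OF B(1) Y] by (auto simp: GL_tensor_def)
qed

text \<open>Freezing the other slots at unit vectors embeds the \<open>i\<close>-th factor
  isometrically into \<open>'v\<close>, which supplies the orthonormal family required by
  \<open>strictly_positive_sqrt\<close>.\<close>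

lemma slot_sqrt:
  assumes dim: "\<And>i. i \<in> {1..l} \<Longrightarrow> d i \<ge> 2" and i: "i \<in> {1..l}" and P: "strictly_positive (d i) P"
  obtains S where "strictly_positive (d i) S" "S * S = P"
proof (rule strictly_positive_sqrt[OF P])
  define e where "e k = (unit_vec (d k) 0 :: real Matrix.vec)" for k
  have e: "e \<in> F" "e(i := unit_vec (d i) a) \<in> F" for a by (auto simp: vec_families_def e_def)
  have "scalar_prod (e k) (e k) = 1" if "k \<in> {1..l}" for k
    using dim[OF that] by (simp add: e_def)
  then have 1: "(\<Prod>k\<in>{1..l}-{i}. scalar_prod (e k) ((e(i := unit_vec (d i) b)) k)) = 1" for b
    by (intro prod.neutral) auto
  show "inner (tensor (e(i := unit_vec (d i) a))) (tensor (e(i := unit_vec (d i) b))) = (if a = b then 1 else 0)"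
    if "a < d i" "b < d i" for a b
    using inner_tensor_upd[OF e(1) e(2)[of b] i, of "unit_vec (d i) a"] 1 that by (simp del: fun_upd_apply) auto
qed

lemma tensor_sqrt:
  assumes dim: "\<And>i. i \<in> {1..l} \<Longrightarrow> d i \<ge> 2"
    and P: "\<And>i. i \<in> {1..l} \<Longrightarrow> strictly_positive (d i) (P i)" and X: "tensor_of_maps P X"
  obtains Y where "Y \<in> A" "Y o\<^sub>L Y = X"
proof -
  have "\<forall>i\<in>{1..l}. \<exists>S. strictly_positive (d i) S \<and> S * S = P i"
    using slot_sqrt[OF dim] P by metis
  then obtain S where S: "\<And>i. i \<in> {1..l} \<Longrightarrow> strictly_positive (d i) (S i)"
    "\<And>i. i \<in> {1..l} \<Longrightarrow> S i * S i = P i" by metis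
  then have Sc: "S i \<in> carrier_mat (d i) (d i)" if "i \<in> {1..l}" for i using that by (simp add: strictly_positive_def)
  obtain Y where Y: "tensor_of_maps S Y" using ex_tensor_of_maps[of S] Sc by metis
  have "Y o\<^sub>L Y = X"
    by (rule tensor_of_maps_unique[OF _ _ tensor_of_maps_compose[OF Sc Sc Y Y] X])
       (use S P in \<open>auto simp: strictly_positive_def\<close>)
  then show ?thesis using that positive_tensorsI[OF S(1) Y] by blast
qed

text \<open>Positivity on decomposable vectors does not pass to their sums, but a square root
  \<open>Y\<close> of \<open>X\<close> in \<open>A\<close> is self-adjoint and injective, so
  \<open>inner v (X v)\<close> is the squared length of \<open>Y v\<close>.\<close>

lemma positive_tensors_pos:
  assumes dim: "\<And>i. i \<in> {1..l} \<Longrightarrow> d i \<ge> 2" and X: "X \<in> A" and v: "v \<noteq> 0"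
  shows "inner v (X v) > 0"
proof -
  obtain P where P: "\<And>i. i \<in> {1..l} \<Longrightarrow> strictly_positive (d i) (P i)" "tensor_of_maps P X"
    using positive_tensorsE[OF X] by metis
  obtain Y where Y: "Y \<in> A" "Y o\<^sub>L Y = X" using tensor_sqrt[OF dim P] by metis
  obtain Z where "Z o\<^sub>L Y = id_blinfun" using positive_tensors_inverse[OF Y(1)] by metis
  then have "Z (Y v) = v" by (metis blinfun_apply_blinfun_compose blinfun_apply_id_blinfun id_apply)
  then have "Y v \<noteq> 0" using v by (auto simp: blinfun.zero_right)
  then have "0 < inner (Y v) (Y v)" by simp
  also have "\<dots> = inner v (X v)" by (simp add: positive_tensors_self_adjoint[OF Y(1)] Y(2)[symmetric])
  finally show ?thesis .
qed

lemma GL_compose: "X \<in> GL \<Longrightarrow> Y \<in> GL \<Longrightarrow> X o\<^sub>L Y \<in> GL"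
  unfolding GL_tensor_def
proof (clarsimp, intro conjI)
  assume "bij (blinfun_apply X)" "bij (blinfun_apply Y)"
  then have "bij (blinfun_apply X \<circ> blinfun_apply Y)" by (rule bij_comp[rotated])
  then show "bij (blinfun_apply (X o\<^sub>L Y))" by (simp add: o_def blinfun_apply_blinfun_compose[abs_def])
qed (auto simp: image_subset_iff)

end

section \<open>Linear maps preserving decomposable vectors\<close>

locale tensor_preserver = tensor_space l d tensor
  for l d and tensor :: "(nat \<Rightarrow> real Matrix.vec) \<Rightarrow> 'v::euclidean_space" +
  fixes T :: "'v \<Rightarrow>\<^sub>L 'v"
  assumes dim: "\<And>i. i \<in> {1..l} \<Longrightarrow> d i \<ge> 2"
    and T: "T \<in> GL_tensor l d tensor"
begin

lemma bij_T: "bij (blinfun_apply T)" using T by (simp add: GL_tensor_def)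

lemma inj_T: "T v = T w \<Longrightarrow> v = w" using bij_T by (metis bij_def injD)

text \<open>The map induced by \<open>T\<close> on decomposable vectors, which is determined only up to rescaling the
  factors.\<close>

definition \<phi> :: "(nat \<Rightarrow> real Matrix.vec) \<Rightarrow> nat \<Rightarrow> real Matrix.vec" where
  "\<phi> x = (SOME p. p \<in> F \<and> tensor p = T (tensor x))"

lemma tensor_image: "x \<in> F \<Longrightarrow> \<exists>p\<in>F. tensor p = T (tensor x)"
  using T unfolding GL_tensor_def by (auto simp: image_subset_iff image_iff) metis

lemma \<phi>_families: "x \<in> F \<Longrightarrow> \<phi> x \<in> F" and tensor_\<phi>: "x \<in> F \<Longrightarrow> tensor (\<phi> x) = T (tensor x)"
  using someI_ex[of "\<lambda>p. p \<in> F \<and> tensor p = T (tensor x)"] tensor_image[of x]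
  unfolding \<phi>_def by auto

lemma \<phi>_nonzero: assumes "x \<in> N" shows "\<phi> x \<in> N"
proof -
  note xF = nonzeroD(1)[OF assms]
  have "tensor x \<noteq> 0" using assms xF by (simp add: tensor_eq_0_iff)
  then have "T (tensor x) \<noteq> 0" using inj_T[of "tensor x" 0] by (auto simp: blinfun.zero_right)
  then have "tensor (\<phi> x) \<noteq> 0" by (simp add: tensor_\<phi> xF)
  then show ?thesis using tensor_eq_0_iff[OF \<phi>_families[OF xF]] by blast
qed

text \<open>An empty \<open>differ\<close> means proportional tensors, which an injective linear map
  preserves and reflects.\<close>

lemma differ_\<phi>_empty_iff:
  assumes x: "x \<in> N" and y: "y \<in> N"
  shows "differ (\<phi> x) (\<phi> y) = {} \<longleftrightarrow> differ x y = {}"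
proof
  assume "differ (\<phi> x) (\<phi> y) = {}"
  then obtain c where "tensor (\<phi> y) = c *\<^sub>R tensor (\<phi> x)"
    using tensor_differ_empty[OF \<phi>_nonzero[OF x] \<phi>_nonzero[OF y]] by metis
  then have "T (tensor y) = T (c *\<^sub>R tensor x)"
    using nonzeroD(1)[OF x] nonzeroD(1)[OF y] by (simp add: tensor_\<phi> blinfun.scaleR_right)
  then have "tensor y = c *\<^sub>R tensor x" by (rule inj_T)
  then show "differ x y = {}" by (rule proportional_tensors[OF x y])
next
  assume "differ x y = {}"
  then obtain c where "tensor y = c *\<^sub>R tensor x"
    using tensor_differ_empty[OF x y] by metis
  then have "tensor (\<phi> y) = c *\<^sub>R tensor (\<phi> x)"
    using nonzeroD(1)[OF x] nonzeroD(1)[OF y] by (simp add: tensor_\<phi> blinfun.scaleR_right)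
  then show "differ (\<phi> x) (\<phi> y) = {}" by (rule proportional_tensors[OF \<phi>_nonzero[OF x] \<phi>_nonzero[OF y]])
qed

text \<open>The tensors of \<open>x\<close> and \<open>y\<close> can be added within slot
  \<open>i\<close>, so the sum of their images is decomposable as well and
  \<open>decomposable_sum_differ\<close> applies.\<close>

lemma differ_\<phi>_le_1:
  assumes x: "x \<in> N" and y: "y \<in> N" and i: "i \<in> {1..l}" and sub: "differ x y \<subseteq> {i}"
    and a: "a \<in> differ (\<phi> x) (\<phi> y)" and b: "b \<in> differ (\<phi> x) (\<phi> y)"
  shows "a = b"
proof -
  obtain c where c: "tensor y = tensor (x(i := c \<cdot>\<^sub>v y i))"
    using tensor_differ_subset[OF x y i sub] by metis
  note xF = nonzeroD(1)[OF x]
  note xi = nonzeroD(2)[OF x i] and yi = nonzeroD(2)[OF y i]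
  define z where "z = x(i := x i + c \<cdot>\<^sub>v y i)"
  have zF: "z \<in> F" using xF xi yi by (auto simp: z_def intro: families_upd)
  have "tensor z = tensor x + tensor y"
    using tensor_add[OF xF i xi, of "c \<cdot>\<^sub>v y i"] yi by (simp add: z_def c)
  then have "tensor (\<phi> x) + tensor (\<phi> y) = tensor (\<phi> z)"
    using xF zF nonzeroD(1)[OF y] by (simp add: tensor_\<phi> blinfun.add_right)
  from decomposable_sum_differ[OF \<phi>_nonzero[OF x] \<phi>_nonzero[OF y] \<phi>_families[OF zF] this a b]
  show ?thesis .
qed

lemma differ_\<phi>_singleton:
  assumes x: "x \<in> N" and y: "y \<in> N" and d: "differ x y = {i}"
  obtains j where "j \<in> {1..l}" "differ (\<phi> x) (\<phi> y) = {j}"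
proof -
  have i: "i \<in> {1..l}" using d differ_subset by blast
  have "differ (\<phi> x) (\<phi> y) \<noteq> {}" using differ_\<phi>_empty_iff[OF x y] d by simp
  then obtain j where j: "j \<in> differ (\<phi> x) (\<phi> y)" by blast
  then have "differ (\<phi> x) (\<phi> y) = {j}" using differ_\<phi>_le_1[OF x y i] d by blast
  then show ?thesis using that j differ_subset by blast
qed

text \<open>If the two image slots were distinct, the images of \<open>y\<close> and
  \<open>z\<close> would differ in both of them, although \<open>y\<close> and \<open>z\<close>
  differ at most in slot \<open>i\<close>.\<close>

lemma slot_triangle:
  assumes x: "x \<in> N" and y: "y \<in> N" and z: "z \<in> N" and xy: "differ x y = {i}" and xz: "differ x z = {i}"
  shows "differ (\<phi> x) (\<phi> y) = differ (\<phi> x) (\<phi> z)"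
proof -
  have i: "i \<in> {1..l}" using xy differ_subset by blast
  obtain j where j: "differ (\<phi> x) (\<phi> y) = {j}" using differ_\<phi>_singleton[OF x y xy] .
  obtain k where k: "differ (\<phi> x) (\<phi> z) = {k}" using differ_\<phi>_singleton[OF x z xz] .
  have yz: "differ y z \<subseteq> {i}"
  proof
    fix a assume "a \<in> differ y z"
    then show "a \<in> {i}" using differ_cong[of a x y z] xy xz by blast
  qed
  have "j = k"
  proof (rule ccontr)
    assume "j \<noteq> k"
    then have "j \<in> differ (\<phi> y) (\<phi> z)" "k \<in> differ (\<phi> y) (\<phi> z)"
      using differ_cong[of j "\<phi> x" "\<phi> z" "\<phi> y"] differ_cong[of k "\<phi> x" "\<phi> y" "\<phi> z"] j k
      by (auto simp: differ_sym)
    with differ_\<phi>_le_1[OF y z i yz] \<open>j \<noteq> k\<close> show False by blast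
  qed
  then show ?thesis using j k by simp
qed

text \<open>If the sides in direction \<open>i\<close> had distinct image slots \<open>j\<close> and
  \<open>j'\<close>, the other two sides would have to carry \<open>j\<close> and \<open>j'\<close>
  in some order. Then the two paths joining one pair of opposite corners would change only
  \<open>j\<close> and only \<open>j'\<close> respectively, so these corners would have proportional
  images.\<close>

lemma slot_square:
  assumes N: "x \<in> N" "y \<in> N" "x' \<in> N" "y' \<in> N" and ik: "i \<noteq> k"
    and xy: "differ x y = {i}" and xy': "differ x' y' = {i}"
    and xx: "differ x x' = {k}" and yy: "differ y y' = {k}"
  shows "differ (\<phi> x) (\<phi> y) = differ (\<phi> x') (\<phi> y')"
proof -
  obtain j where j: "differ (\<phi> x) (\<phi> y) = {j}" using differ_\<phi>_singleton[OF N(1,2) xy] .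
  obtain j' where j': "differ (\<phi> x') (\<phi> y') = {j'}" using differ_\<phi>_singleton[OF N(3,4) xy'] .
  obtain m where m: "differ (\<phi> x) (\<phi> x') = {m}" using differ_\<phi>_singleton[OF N(1,3) xx] .
  obtain m' where m': "differ (\<phi> y) (\<phi> y') = {m'}" using differ_\<phi>_singleton[OF N(2,4) yy] .
  have tr: "a \<notin> differ p r" if "a \<notin> differ p q" "a \<notin> differ q r" for a p q r
    using differ_cong[OF that(1), of r] that(2) by blast
  \<comment> \<open>Opposite corners differ in slot \<open>i\<close>, so their images are not
    proportional; this excludes the two configurations left at the end.\<close>
  have "i \<in> differ x y'" using differ_cong[of i y y' x] xy yy ik by (auto simp: differ_sym)
  then have 1: "differ (\<phi> x) (\<phi> y') \<noteq> {}" using differ_\<phi>_empty_iff[OF N(1,4)] by blast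
  have "i \<in> differ y x'" using differ_cong[of i x x' y] xy xx ik by (auto simp: differ_sym)
  then have 2: "differ (\<phi> y) (\<phi> x') \<noteq> {}" using differ_\<phi>_empty_iff[OF N(2,3)] by blast
  have J: "a \<in> differ (\<phi> x) (\<phi> y) \<longleftrightarrow> a = j" "a \<in> differ (\<phi> y) (\<phi> x) \<longleftrightarrow> a = j"
    "a \<in> differ (\<phi> x') (\<phi> y') \<longleftrightarrow> a = j'" "a \<in> differ (\<phi> y') (\<phi> x') \<longleftrightarrow> a = j'"
    "a \<in> differ (\<phi> x) (\<phi> x') \<longleftrightarrow> a = m" "a \<in> differ (\<phi> x') (\<phi> x) \<longleftrightarrow> a = m"
    "a \<in> differ (\<phi> y) (\<phi> y') \<longleftrightarrow> a = m'" "a \<in> differ (\<phi> y') (\<phi> y) \<longleftrightarrow> a = m'" for a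
    using j j' m m' by (auto simp: differ_sym)
  have "j = j'"
  proof (rule ccontr)
    assume ne: "j \<noteq> j'"
    have A: "m = j \<or> m' = j"
      using tr[of j "\<phi> x" "\<phi> x'" "\<phi> y'"] tr[of j "\<phi> x" "\<phi> y'" "\<phi> y"] ne by (auto simp: J)
    have B: "m = j' \<or> m' = j'"
      using tr[of j' "\<phi> x'" "\<phi> x" "\<phi> y"] tr[of j' "\<phi> x'" "\<phi> y" "\<phi> y'"] ne by (auto simp: J)
    from A B ne consider "m = j" "m' = j'" | "m = j'" "m' = j" by blast
    then show False
    proof cases
      case 1
      have "a \<notin> differ (\<phi> y) (\<phi> x')" for a
        using tr[of a "\<phi> y" "\<phi> x" "\<phi> x'"] tr[of a "\<phi> y" "\<phi> y'" "\<phi> x'"] ne 1 by (auto simp: J)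
      with 2 show False by blast
    next
      case 2
      have "a \<notin> differ (\<phi> x) (\<phi> y')" for a
        using tr[of a "\<phi> x" "\<phi> y" "\<phi> y'"] tr[of a "\<phi> x" "\<phi> x'" "\<phi> y'"] ne 2 by (auto simp: J)
      with 1 show False by blast
    qed
  qed
  then show ?thesis using j j' by simp
qed

text \<open>Induction on the number of slots other than \<open>i\<close> in which \<open>x\<close>
  and \<open>x'\<close> differ: \<open>slot_square\<close> crosses one such slot at a time, and
  \<open>slot_triangle\<close> settles the case in which none is left.\<close>

lemma slot_constant:
  assumes N: "x \<in> N" "y \<in> N" "x' \<in> N" "y' \<in> N"
    and xy: "differ x y = {i}" and xy': "differ x' y' = {i}"
  shows "differ (\<phi> x) (\<phi> y) = differ (\<phi> x') (\<phi> y')"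
  using N(3,4) xy'
proof (induction "card (differ x x' - {i})" arbitrary: x' y')
  case 0
  have "finite (differ x x')" using differ_subset finite_subset by blast
  then have sub: "differ x x' \<subseteq> {i}" using 0 by auto
  show ?case
  proof (cases "differ x x' = {}")
    case True
    then have "a \<in> differ x y' \<longleftrightarrow> a \<in> differ x' y'" for a using differ_cong[of a x x' y'] by simp
    then have "differ x y' = {i}" using 0(4) by auto
    from slot_triangle[OF N(1,2) 0(3) xy this]
    have 1: "differ (\<phi> x) (\<phi> y) = differ (\<phi> x) (\<phi> y')" .
    have "differ (\<phi> x) (\<phi> x') = {}" using differ_\<phi>_empty_iff[OF N(1) 0(2)] True by simp
    then have "a \<in> differ (\<phi> x) (\<phi> y') \<longleftrightarrow> a \<in> differ (\<phi> x') (\<phi> y')" for a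
      using differ_cong[of a "\<phi> x" "\<phi> x'" "\<phi> y'"] by simp
    then have "differ (\<phi> x) (\<phi> y') = differ (\<phi> x') (\<phi> y')" by auto
    with 1 show ?thesis by simp
  next
    case False
    \<comment> \<open>The triangle at \<open>x\<close> passes from the pair \<open>x\<close>,
      \<open>y\<close> to \<open>x\<close>, \<open>x'\<close>, and the triangle at \<open>x'\<close>
      passes on to \<open>x'\<close>, \<open>y'\<close>.\<close>
    then have "differ x x' = {i}" using sub by blast
    moreover from this have "differ x' x = {i}" by (subst differ_sym)
    ultimately have "differ (\<phi> x) (\<phi> y) = differ (\<phi> x) (\<phi> x')" "differ (\<phi> x') (\<phi> x) = differ (\<phi> x') (\<phi> y')"
      using slot_triangle[OF N(1,2) 0(2) xy] slot_triangle[OF 0(2) N(1) 0(3) _ 0(4)] by blast+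
    then show ?thesis using differ_sym[of "\<phi> x" "\<phi> x'"] by (elim trans) simp
  qed
next
  case (Suc n)
  then have "differ x x' - {i} \<noteq> {}" by (metis card.empty nat.distinct(1))
  then obtain k where k: "k \<in> differ x x'" "k \<noteq> i" by blast
  have kI: "k \<in> {1..l}" using k differ_subset by blast
  note xk = nonzeroD(2,3)[OF N(1) kI]
  \<comment> \<open>Both families receive the \<open>k\<close>-th factor of \<open>x\<close>: they
    still differ exactly in \<open>i\<close>, and \<open>x2\<close> is one slot closer to
    \<open>x\<close>.\<close>
  define x2 y2 where "x2 = x'(k := x k)" and "y2 = y'(k := x k)"
  have N2: "x2 \<in> N" "y2 \<in> N" using nonzero_upd[OF Suc(3) xk] nonzero_upd[OF Suc(4) xk] by (auto simp: x2_def y2_def)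
  have d: "differ x x2 = differ x x' - {k}" by (simp add: x2_def differ_upd_restore)
  have "card (differ x x' - {i}) = Suc (card (differ x x' - {i} - {k}))"
    using k finite_subset[OF differ_subset[of x x']] by (intro card.remove) auto
  then have "n = card (differ x x2 - {i})" using Suc(2) d by (metis Diff_insert2 Diff_insert diff_Suc_1)
  moreover have i2: "differ x2 y2 = {i}" using Suc(5) k by (simp add: x2_def y2_def differ_upd_upd)
  ultimately have 1: "differ (\<phi> x) (\<phi> y) = differ (\<phi> x2) (\<phi> y2)" using Suc(1) N2 by blast
  have "\<not> parallel (x' k) (x k)" using k parallel_sym by (auto simp: differ_def)
  moreover have "parallel (x' k) (y' k)" using Suc(5) k kI by (auto simp: differ_def)
  ultimately have "differ x' x2 = {k}" "differ y' y2 = {k}"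
    using differ_upd_self_eq[OF kI] parallel_trans unfolding x2_def y2_def by blast+
  then have "differ x2 x' = {k}" "differ y2 y' = {k}" by (metis differ_sym)+
  then have "differ (\<phi> x2) (\<phi> y2) = differ (\<phi> x') (\<phi> y')"
    using slot_square[OF N2 Suc(3,4) k(2)[symmetric] i2 Suc(5)] by simp
  with 1 show ?case by simp
qed

text \<open>The factor of the image that changes when the \<open>i\<close>-th factor of the argument does.\<close>

definition \<sigma> :: "nat \<Rightarrow> nat" where
  "\<sigma> i = (SOME j. j \<in> {1..l} \<and> (\<forall>x\<in>N. \<forall>y\<in>N. differ x y = {i} \<longrightarrow> differ (\<phi> x) (\<phi> y) = {j}))"

lemma \<sigma>:
  assumes i: "i \<in> {1..l}"
  shows "\<sigma> i \<in> {1..l}" and "x \<in> N \<Longrightarrow> y \<in> N \<Longrightarrow> differ x y = {i} \<Longrightarrow> differ (\<phi> x) (\<phi> y) = {\<sigma> i}"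
proof -
  have "\<exists>j. j \<in> {1..l} \<and> (\<forall>x\<in>N. \<forall>y\<in>N. differ x y = {i} \<longrightarrow> differ (\<phi> x) (\<phi> y) = {j})"
  \<comment> \<open>Without such a pair the condition on \<open>j\<close> is vacuous and
    \<open>j = i\<close> serves as a default.\<close>
  proof (cases "\<exists>x\<in>N. \<exists>y\<in>N. differ x y = {i}")
    case True
    then obtain x y where xy: "x \<in> N" "y \<in> N" "differ x y = {i}" by blast
    obtain j where "j \<in> {1..l}" "differ (\<phi> x) (\<phi> y) = {j}" using differ_\<phi>_singleton[OF xy] .
    then show ?thesis using slot_constant[OF xy(1,2) _ _ xy(3)] by metis
  qed (use i in blast)
  from someI_ex[OF this]
  show "\<sigma> i \<in> {1..l}" "x \<in> N \<Longrightarrow> y \<in> N \<Longrightarrow> differ x y = {i} \<Longrightarrow> differ (\<phi> x) (\<phi> y) = {\<sigma> i}"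
    unfolding \<sigma>_def by blast+
qed

text \<open>Turn \<open>y\<close> into \<open>x\<close> by restoring one differing slot at a time;
  restoring slot \<open>i\<close> changes only slot \<open>\<sigma> i\<close> of the image.\<close>

lemma differ_\<phi>_subset:
  assumes x: "x \<in> N" and y: "y \<in> N" and j: "j \<in> differ (\<phi> x) (\<phi> y)"
  shows "j \<in> \<sigma> ` differ x y"
  using y j
proof (induction "card (differ x y)" arbitrary: y)
  case 0
  then have "differ x y = {}" using finite_subset[OF differ_subset[of x y]] by auto
  then show ?case using differ_\<phi>_empty_iff[OF x 0(2)] 0(3) by blast
next
  case (Suc n)
  then have "differ x y \<noteq> {}" by (metis card.empty nat.distinct(1))
  then obtain i where i: "i \<in> differ x y" by blast
  then have iI: "i \<in> {1..l}" using differ_subset by blast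
  define z where "z = y(i := x i)"
  have z: "z \<in> N" unfolding z_def using nonzero_upd[OF Suc(3)] nonzeroD(2,3)[OF x iI] by blast
  have d: "differ x z = differ x y - {i}" by (simp add: z_def differ_upd_restore)
  have "\<not> parallel (y i) (x i)" using i parallel_sym by (auto simp: differ_def)
  then have yz: "differ y z = {i}" unfolding z_def by (rule differ_upd_self_eq[OF iI])
  show ?case
  proof (cases "j \<in> differ (\<phi> x) (\<phi> z)")
    case True
    have "n = card (differ x z)"
      using Suc(2) i finite_subset[OF differ_subset[of x y]] by (simp add: d card_Diff_singleton)
    then have "j \<in> \<sigma> ` differ x z" using Suc(1) z True by blast
    then show ?thesis using d by blast
  next
    case False
    then have "j \<in> differ (\<phi> y) (\<phi> z)"
      using differ_cong[of j "\<phi> x" "\<phi> z" "\<phi> y"] Suc(4) differ_sym by blast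
    then have "j = \<sigma> i" using \<sigma>(2)[OF iI Suc(3) z yz] by blast
    then show ?thesis using i by blast
  qed
qed

text \<open>A base point, at which the maps on the factors are read off and from which other
  families are reached slot by slot.\<close>

definition x0 :: "nat \<Rightarrow> real Matrix.vec" where "x0 i = unit_vec (d i) 0"

lemma x0: "x0 \<in> N"
proof -
  have "unit_vec (d i) 0 \<noteq> (0\<^sub>v (d i) :: real Matrix.vec)" if "i \<in> {1..l}" for i
    using dim[OF that] by auto
  then show ?thesis by (auto simp: nonzero_families_def vec_families_def x0_def)
qed

text \<open>If no slot is mapped to \<open>j\<close>, then the \<open>j\<close>-th factor of all the images is the same up to scaling,
  so they do not span.\<close>

lemma \<sigma>_bij: "bij_betw \<sigma> {1..l} {1..l}"
proof -
  have "j \<in> \<sigma> ` {1..l}" if j: "j \<in> {1..l}" for j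
  proof (rule ccontr)
    assume nj: "j \<notin> \<sigma> ` {1..l}"
    define p where "p = \<phi> x0"
    have p: "p \<in> N" unfolding p_def by (rule \<phi>_nonzero[OF x0])
    note pj = nonzeroD(2,3)[OF p j]
    \<comment> \<open>In dimension at least two some \<open>v\<close> is not parallel to
      \<open>p j\<close>, which yields a nonzero \<open>w\<close> orthogonal to \<open>p j\<close>.
      With \<open>w\<close> in slot \<open>j\<close>, \<open>p\<close> becomes a family whose
      nonzero tensor is orthogonal to all images, yet is an image itself.\<close>
    obtain v where v: "v \<in> carrier_vec (d j)" "v \<noteq> 0\<^sub>v (d j)" "\<not> parallel (p j) v"
      using ex_not_parallel[OF dim[OF j] pj(1)] .
    then have "\<not> parallel v (p j)" using parallel_sym by blast
    then obtain w where w: "w \<in> carrier_vec (d j)" "scalar_prod (p j) w = 0" "scalar_prod v w \<noteq> 0"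
      using ex_orthogonal_not_orthogonal[OF v(1,2) pj] by blast
    have w0: "w \<noteq> 0\<^sub>v (d j)" using w(3) v(1) by auto
    define q where "q = p(j := w)"
    have q: "q \<in> N" unfolding q_def by (rule nonzero_upd[OF p w(1) w0])
    have orth: "inner (T (tensor x)) (tensor q) = 0" if x: "x \<in> F" for x
    proof (cases "x \<in> N")
      case True
      have "j \<notin> differ p (\<phi> x)" unfolding p_def
        using differ_\<phi>_subset[OF x0 True, of j] nj differ_subset by blast
      then obtain c where "\<phi> x j = c \<cdot>\<^sub>v p j" using j by (auto simp: differ_def parallel_def)
      then have "scalar_prod (\<phi> x j) (q j) = 0" using pj w by (simp add: q_def)
      then have "inner (tensor (\<phi> x)) (tensor q) = 0"
        using j by (auto simp: inner_tensor[OF nonzeroD(1)[OF \<phi>_nonzero[OF True]] nonzeroD(1)[OF q]])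
      then show ?thesis by (simp add: tensor_\<phi>[OF x])
    next
      case False
      then have "tensor x = 0" using x by (simp add: tensor_eq_0_iff)
      then show ?thesis by (simp add: blinfun.zero_right)
    qed
    have "(\<lambda>v. inner (T v) (tensor q)) = (\<lambda>v. 0)"
      by (rule linear_eq_on_tensors)
         (auto intro!: linearI simp: blinfun.add_right blinfun.scaleR_right inner_add_left orth)
    moreover obtain v where "T v = tensor q" using bij_T by (metis bij_pointE)
    ultimately have "inner (tensor q) (tensor q) = 0" by (metis)
    then show False using q nonzeroD(1)[OF q] by (simp add: tensor_eq_0_iff)
  qed
  then have "\<sigma> ` {1..l} = {1..l}" using \<sigma>(1) by blast
  then show ?thesis by (simp add: bij_betw_def eq_card_imp_inj_on)
qed

section \<open>The linear maps on the factors\<close>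

definition \<tau> :: "nat \<Rightarrow> nat" where "\<tau> = inv_into {1..l} \<sigma>"

lemma \<tau>_bij: "bij_betw \<tau> {1..l} {1..l}"
  unfolding \<tau>_def by (rule bij_betw_inv_into[OF \<sigma>_bij])

lemma \<tau>: assumes "j \<in> {1..l}" shows "\<tau> j \<in> {1..l}" "\<sigma> (\<tau> j) = j"
  using assms bij_betwE[OF \<tau>_bij] bij_betw_inv_into_right[OF \<sigma>_bij] by (auto simp: \<tau>_def)

lemma \<tau>_\<sigma>: assumes "i \<in> {1..l}" shows "\<tau> (\<sigma> i) = i"
  using assms bij_betw_inv_into_left[OF \<sigma>_bij] by (auto simp: \<tau>_def)

text \<open>If the tensor of \<open>x0(\<tau> j := u)\<close> is mapped to the tensor of \<open>(\<phi> x0)(j := w)\<close>, this is the \<open>a\<close>-th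
  coordinate of \<open>w\<close>.\<close>

definition slot_coeff :: "nat \<Rightarrow> nat \<Rightarrow> real Matrix.vec \<Rightarrow> real" where
  "slot_coeff j a u = inner (T (tensor (x0(\<tau> j := u)))) (tensor ((\<phi> x0)(j := unit_vec (d j) a))) /
     (\<Prod>k\<in>{1..l}-{j}. scalar_prod (\<phi> x0 k) (\<phi> x0 k))"

definition B :: "nat \<Rightarrow> real mat" where
  "B j = Matrix.mat (d j) (d (\<tau> j)) (\<lambda>(a, b). slot_coeff j a (unit_vec (d (\<tau> j)) b))"

lemma B_carrier: "B j \<in> carrier_mat (d j) (d (\<tau> j))" by (simp add: B_def)

lemma B_vec_carrier: "B j *\<^sub>v u \<in> carrier_vec (d j)" by (rule carrier_vecI) (simp add: B_def)

text \<open>Only slot \<open>j\<close> of the image moves with slot \<open>\<tau> j\<close> of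
  \<open>x0\<close>, so the image has some \<open>w\<close> there. The coordinates of
  \<open>w\<close> are the values of \<open>slot_coeff\<close>, which is linear in \<open>u\<close>;
  hence \<open>w\<close> is given by the matrix \<open>B j\<close>.\<close>

lemma T_slot:
  assumes j: "j \<in> {1..l}" and u: "u \<in> carrier_vec (d (\<tau> j))"
  shows "T (tensor (x0(\<tau> j := u))) = tensor ((\<phi> x0)(j := B j *\<^sub>v u))"
proof -
  define p where "p = \<phi> x0"
  have p: "p \<in> N" unfolding p_def by (rule \<phi>_nonzero[OF x0])
  note pF = nonzeroD(1)[OF p] and x0F = nonzeroD(1)[OF x0]
  have tj: "\<tau> j \<in> {1..l}" "\<sigma> (\<tau> j) = j" using \<tau>[OF j] .
  have pk: "scalar_prod (p k) (p k) \<noteq> 0" if "k \<in> {1..l}" for k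
    using scalar_prod_self_pos[OF nonzeroD(2,3)[OF p that]] by simp
  \<comment> \<open>The results on \<open>\<phi>\<close> concern nonzero families, so
    \<open>u = 0\<close> is treated apart, with \<open>w = 0\<close>.\<close>
  obtain w where w: "w \<in> carrier_vec (d j)" "T (tensor (x0(\<tau> j := u))) = tensor (p(j := w))"
  proof (cases "u = 0\<^sub>v (d (\<tau> j))")
    case True
    have "x0(\<tau> j := u) \<in> F" "x0(\<tau> j := u) \<notin> N" using u x0F True tj
      by (auto intro: families_upd simp: nonzero_families_def)
    then have 1: "tensor (x0(\<tau> j := u)) = 0" using tensor_eq_0_iff by blast
    have "p(j := 0\<^sub>v (d j)) \<in> F" "p(j := 0\<^sub>v (d j)) \<notin> N" using pF j
      by (auto intro: families_upd simp: nonzero_families_def)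
    then have 2: "tensor (p(j := 0\<^sub>v (d j))) = 0" using tensor_eq_0_iff by blast
    show ?thesis using that[of "0\<^sub>v (d j)"] 1 2 by (simp add: blinfun.zero_right)
  next
    case False
    have xu: "x0(\<tau> j := u) \<in> N" by (rule nonzero_upd[OF x0 u False])
    have "differ p (\<phi> (x0(\<tau> j := u))) \<subseteq> {j}"
    proof
      fix a assume "a \<in> differ p (\<phi> (x0(\<tau> j := u)))"
      then have "a \<in> \<sigma> ` differ x0 (x0(\<tau> j := u))" unfolding p_def by (rule differ_\<phi>_subset[OF x0 xu])
      then show "a \<in> {j}" using differ_upd_self[of x0 "\<tau> j" u] tj by blast
    qed
    from tensor_differ_subset[OF p \<phi>_nonzero[OF xu] j this]
    obtain c where "tensor (\<phi> (x0(\<tau> j := u))) = tensor (p(j := c \<cdot>\<^sub>v \<phi> (x0(\<tau> j := u)) j))" by metis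
    moreover have "c \<cdot>\<^sub>v \<phi> (x0(\<tau> j := u)) j \<in> carrier_vec (d j)"
      using nonzeroD(2)[OF \<phi>_nonzero[OF xu] j] by simp
    ultimately show ?thesis using that nonzeroD(1)[OF xu] by (metis tensor_\<phi>)
  qed
  have slot_coeff: "slot_coeff j a u = vec_index w a" if a: "a < d j" for a
  proof -
    have "p(j := unit_vec (d j) a) \<in> F" using pF by (auto intro: families_upd)
    from inner_tensor_upd[OF pF this j w(1)]
    have "inner (tensor (p(j := w))) (tensor (p(j := unit_vec (d j) a))) =
      scalar_prod w (unit_vec (d j) a) * (\<Prod>k\<in>{1..l}-{j}. scalar_prod (p k) (p k))"
      by (auto intro!: prod.cong arg_cong2[where f = "(*)"])
    moreover have "(\<Prod>k\<in>{1..l}-{j}. scalar_prod (p k) (p k)) \<noteq> 0" using pk by auto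
    ultimately show ?thesis using w a unfolding slot_coeff_def p_def[symmetric] by simp
  qed
  have "slot_coeff j a u = (\<Sum>b<d (\<tau> j). slot_coeff j a (unit_vec (d (\<tau> j)) b) * vec_index u b)" for a
    by (rule linear_functional_vec[OF _ _ u])
       (simp_all add: slot_coeff_def tensor_add[OF x0F tj(1)] tensor_smult[OF x0F tj(1)]
          blinfun.add_right blinfun.scaleR_right inner_add_left add_divide_distrib)
  then have "B j *\<^sub>v u = w"
    using w(1) u slot_coeff by (intro eq_vecI) (auto simp: B_def scalar_prod_lessThan intro!: sum.cong)
  then show ?thesis using w by (simp add: p_def)
qed

lemma B_nonzero:
  assumes j: "j \<in> {1..l}" and u: "u \<in> carrier_vec (d (\<tau> j))" "u \<noteq> 0\<^sub>v (d (\<tau> j))"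
  shows "B j *\<^sub>v u \<noteq> 0\<^sub>v (d j)"
proof
  assume 0: "B j *\<^sub>v u = 0\<^sub>v (d j)"
  have "(\<phi> x0)(j := 0\<^sub>v (d j)) \<in> F" "(\<phi> x0)(j := 0\<^sub>v (d j)) \<notin> N"
    using nonzeroD(1)[OF \<phi>_nonzero[OF x0]] j by (auto intro: families_upd simp: nonzero_families_def)
  then have "tensor ((\<phi> x0)(j := B j *\<^sub>v u)) = 0" using tensor_eq_0_iff 0 by auto
  then have "T (tensor (x0(\<tau> j := u))) = T 0" using T_slot[OF j u(1)] by (simp add: blinfun.zero_right)
  then have "tensor (x0(\<tau> j := u)) = 0" by (rule inj_T)
  then show False using nonzero_upd[OF x0 u] nonzeroD(1) tensor_eq_0_iff by blast
qed

text \<open>The candidate for the action of \<open>T\<close> on families; unlike the choice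
  \<open>\<phi>\<close>, it is multilinear at the level of tensors.\<close>

definition G :: "(nat \<Rightarrow> real Matrix.vec) \<Rightarrow> nat \<Rightarrow> real Matrix.vec" where
  "G x j = B j *\<^sub>v x (\<tau> j)"

lemma G_families: "G x \<in> F"
  by (auto simp: vec_families_def G_def B_vec_carrier)

lemma G_nonzero: assumes x: "x \<in> N" shows "G x \<in> N"
  using B_nonzero nonzeroD(2,3)[OF x \<tau>(1)] G_families by (auto simp: nonzero_families_def G_def)

lemma G_upd:
  assumes i: "i \<in> {1..l}" and x: "x \<in> F" and u: "u \<in> carrier_vec (d i)"
  shows "tensor (G (x(i := u))) = tensor ((G x)(\<sigma> i := B (\<sigma> i) *\<^sub>v u))"
proof (rule tensor_cong[OF G_families])
  fix j assume j: "j \<in> {1..l}"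
  have "\<tau> j = i \<longleftrightarrow> j = \<sigma> i" using \<tau>[OF j] \<tau>_\<sigma>[OF i] by auto
  then show "G (x(i := u)) j = ((G x)(\<sigma> i := B (\<sigma> i) *\<^sub>v u)) j" by (auto simp: G_def)
qed

lemma G_add_smult:
  assumes i: "i \<in> {1..l}" and x: "x \<in> F" and u: "u \<in> carrier_vec (d i)" and v: "v \<in> carrier_vec (d i)"
  shows "tensor (G (x(i := u + v))) = tensor (G (x(i := u))) + tensor (G (x(i := v)))"
    and "tensor (G (x(i := c \<cdot>\<^sub>v u))) = c *\<^sub>R tensor (G (x(i := u)))"
proof -
  have B: "B (\<sigma> i) \<in> carrier_mat (d (\<sigma> i)) (d i)" using B_carrier[of "\<sigma> i"] \<tau>_\<sigma>[OF i] by simp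
  show "tensor (G (x(i := u + v))) = tensor (G (x(i := u))) + tensor (G (x(i := v)))"
    using u v \<sigma>(1)[OF i] B_vec_carrier
    by (simp add: G_upd[OF i x] mult_add_distrib_mat_vec[OF B] tensor_add[OF G_families])
  show "tensor (G (x(i := c \<cdot>\<^sub>v u))) = c *\<^sub>R tensor (G (x(i := u)))"
    using u \<sigma>(1)[OF i] B_vec_carrier
    by (simp add: G_upd[OF i x] mult_mat_vec[OF B] tensor_smult[OF G_families])
qed

text \<open>Up to scaling, the \<open>j\<close>-th factor of the image depends only on slot
  \<open>\<tau> j\<close> of \<open>x\<close>. So \<open>x\<close> may be replaced by
  \<open>x0\<close> with that one slot changed, where \<open>T_slot\<close> gives the
  factor.\<close>

lemma differ_\<phi>_G: assumes x: "x \<in> N" shows "differ (\<phi> x) (G x) = {}"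
proof (rule ccontr)
  assume "differ (\<phi> x) (G x) \<noteq> {}"
  then obtain j where j: "j \<in> differ (\<phi> x) (G x)" by blast
  then have jI: "j \<in> {1..l}" using differ_subset by blast
  have tj: "\<tau> j \<in> {1..l}" "\<sigma> (\<tau> j) = j" using \<tau>[OF jI] .
  note xj = nonzeroD(2,3)[OF x tj(1)]
  define z where "z = x0(\<tau> j := x (\<tau> j))"
  have z: "z \<in> N" unfolding z_def by (rule nonzero_upd[OF x0 xj])
  have "\<tau> j \<notin> differ x z" by (simp add: differ_def z_def)
  moreover have "\<tau> j \<in> differ x z" if "j \<in> \<sigma> ` differ x z"
    using that \<tau>_\<sigma> differ_subset[of x z] by auto
  ultimately have "j \<notin> \<sigma> ` differ x z" by blast
  then have 1: "j \<notin> differ (\<phi> x) (\<phi> z)" using differ_\<phi>_subset[OF x z] by blast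
  have "tensor ((\<phi> x0)(j := G x j)) = 1 *\<^sub>R tensor (\<phi> z)"
    using T_slot[OF jI xj(1)] nonzeroD(1)[OF z] by (simp add: tensor_\<phi> z_def G_def)
  moreover have "(\<phi> x0)(j := G x j) \<in> N"
    using nonzero_upd[OF \<phi>_nonzero[OF x0]] nonzeroD(2,3)[OF G_nonzero[OF x] jI] by blast
  ultimately have "differ (\<phi> z) ((\<phi> x0)(j := G x j)) = {}" by (intro proportional_tensors \<phi>_nonzero z)
  then have "j \<notin> differ (\<phi> z) (G x)" by (auto simp: differ_def)
  with 1 j show False using differ_cong by blast
qed

lemma T_G_nonzero:
  assumes "x \<in> N" obtains c where "c \<noteq> 0" "T (tensor x) = c *\<^sub>R tensor (G x)"
proof -
  have "differ (G x) (\<phi> x) = {}" using differ_\<phi>_G[OF assms] by (simp add: differ_sym)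
  from tensor_differ_empty[OF G_nonzero[OF assms] \<phi>_nonzero[OF assms] this]
  show ?thesis using that by (metis tensor_\<phi> nonzeroD(1)[OF assms])
qed

text \<open>A linear map that agrees with an injective linear map up to pointwise scalars on a space of
  dimension at least two is a scalar multiple of it; here both are regarded as maps of the \<open>i\<close>-th
  factor only.\<close>

lemma scalar_upd_eq:
  assumes x: "x \<in> N" and i: "i \<in> {1..l}" and u: "u \<in> carrier_vec (d i)" "u \<noteq> 0\<^sub>v (d i)"
    and c: "T (tensor x) = c *\<^sub>R tensor (G x)"
  shows "T (tensor (x(i := u))) = c *\<^sub>R tensor (G (x(i := u)))"
proof -
  note xF = nonzeroD(1)[OF x] and xi = nonzeroD(2,3)[OF x i]
  have xx: "x = x(i := x i)" by simp
  show ?thesis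
  proof (cases "parallel (x i) u")
    case True
    then obtain a where a: "u = a \<cdot>\<^sub>v x i" by (auto simp: parallel_def)
    show ?thesis
      using c xi by (simp add: a tensor_smult[OF xF i] G_add_smult[OF i xF] blinfun.scaleR_right scaleR_left_commute)
  next
    case False
    \<comment> \<open>The scalars \<open>c\<close>, \<open>a\<close>, \<open>b\<close> belong to
      \<open>x\<close>, \<open>y\<close> and their sum \<open>z\<close> in slot \<open>i\<close>.
      The tensors of \<open>G x\<close> and \<open>G y\<close> are linearly independent since
      \<open>y\<close> differs from \<open>x\<close>, so comparing coefficients makes the three
      scalars equal.\<close>
    define y z where "y = x(i := u)" and "z = x(i := x i + u)"
    have y: "y \<in> N" unfolding y_def by (rule nonzero_upd[OF x u])
    have xy: "differ x y = {i}" unfolding y_def by (rule differ_upd_self_eq[of i x u, OF i False])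
    have "x i + u \<noteq> 0\<^sub>v (d i)"
    proof
      assume 0: "x i + u = 0\<^sub>v (d i)"
      have "u = (-1) \<cdot>\<^sub>v x i"
      proof (rule eq_vecI)
        fix k assume "k < dim_vec ((-1) \<cdot>\<^sub>v x i)"
        then have k: "k < d i" using xi by simp
        have "vec_index (x i + u) k = 0" using 0 k by simp
        then show "vec_index u k = vec_index ((-1) \<cdot>\<^sub>v x i) k" using k xi u by simp
      qed (use xi u in simp)
      then show False using False unfolding parallel_def by (metis zero_neq_neg_one)
    qed
    then have z: "z \<in> N" unfolding z_def using xi u by (intro nonzero_upd[OF x]) auto
    obtain a where a: "a \<noteq> 0" "T (tensor y) = a *\<^sub>R tensor (G y)" using T_G_nonzero[OF y] .
    obtain b where b: "T (tensor z) = b *\<^sub>R tensor (G z)" using T_G_nonzero[OF z] .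
    have "tensor z = tensor x + tensor y"
      using tensor_add[OF xF i xi(1) u(1)] by (simp add: z_def y_def)
    moreover have "tensor (G z) = tensor (G x) + tensor (G y)"
      using G_add_smult(1)[OF i xF xi(1) u(1)] by (simp add: z_def y_def)
    ultimately have "b *\<^sub>R (tensor (G x) + tensor (G y)) = c *\<^sub>R tensor (G x) + a *\<^sub>R tensor (G y)"
      using b c a by (simp add: blinfun.add_right)
    then have eq: "(c - b) *\<^sub>R tensor (G x) = (b - a) *\<^sub>R tensor (G y)" by (simp add: algebra_simps)
    have indep: "tensor (G y) \<noteq> t *\<^sub>R tensor (G x)" for t
    proof
      assume "tensor (G y) = t *\<^sub>R tensor (G x)"
      then have "differ (G x) (G y) = {}" by (rule proportional_tensors[OF G_nonzero[OF x] G_nonzero[OF y]])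
      then have "differ (\<phi> x) (\<phi> y) = {}" using differ_\<phi>_G[OF x] differ_\<phi>_G[OF y] differ_cong differ_sym
        by (metis equals0I empty_iff)
      then show False using differ_\<phi>_empty_iff[OF x y] xy by simp
    qed
    have "b = a"
    proof (rule ccontr)
      assume "b \<noteq> a"
      then have "tensor (G y) = inverse (b - a) *\<^sub>R ((b - a) *\<^sub>R tensor (G y))" by simp
      also have "\<dots> = (inverse (b - a) * (c - b)) *\<^sub>R tensor (G x)" by (simp only: eq[symmetric] scaleR_scaleR)
      finally have "tensor (G y) = (inverse (b - a) * (c - b)) *\<^sub>R tensor (G x)" .
      with indep show False by blast
    qed
    moreover have "tensor (G x) \<noteq> 0" using G_nonzero[OF x] G_families by (simp add: tensor_eq_0_iff)
    ultimately have "c = a" using eq by simp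
    then show ?thesis using a by (simp add: y_def)
  qed
qed

text \<open>The two sides agree up to a scalar depending on \<open>x\<close>. It is 1 at
  \<open>x0\<close> and is unchanged when one factor is replaced, by \<open>scalar_upd_eq\<close>,
  so the factors of \<open>x0\<close> are exchanged for those of \<open>x\<close> one by
  one.\<close>

lemma T_tensor:
  assumes x: "x \<in> F"
  shows "T (tensor x) = tensor (G x)"
proof (cases "x \<in> N")
  case True
  \<comment> \<open>\<open>T_slot\<close> is applied with the unchanged factor of \<open>x0\<close>;
    with the other slots fixed, the tensor determines the factor in slot \<open>j\<close>
    exactly.\<close>
  have G0: "G x0 j = \<phi> x0 j" if j: "j \<in> {1..l}" for j
  proof -
    have "tensor ((\<phi> x0)(j := \<phi> x0 j)) = tensor ((\<phi> x0)(j := G x0 j))"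
      using T_slot[OF j nonzeroD(2)[OF x0 \<tau>(1)[OF j]]] tensor_\<phi>[OF nonzeroD(1)[OF x0]] by (simp add: G_def)
    from tensor_upd_inj[OF \<phi>_nonzero[OF x0] j _ _ this] show ?thesis
      using nonzeroD(2)[OF \<phi>_nonzero[OF x0] j] by (simp add: G_def B_vec_carrier)
  qed
  have "T (tensor x0) = tensor (G x0)"
    using tensor_cong[OF G_families G0] tensor_\<phi>[OF nonzeroD(1)[OF x0]] by simp
  define m where "m E k = (if k \<in> E then x k else x0 k)" for E k
  have "m E \<in> N \<and> T (tensor (m E)) = 1 *\<^sub>R tensor (G (m E))" if "finite E" "E \<subseteq> {1..l}" for E
    using that
  proof (induction E rule: finite_induct)
    case empty
    have "m {} = x0" by (auto simp: m_def)
    then show ?case using x0 \<open>T (tensor x0) = tensor (G x0)\<close> by simp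
  next
    case (insert i E)
    have "m (insert i E) = (m E)(i := x i)" by (auto simp: m_def)
    moreover have i: "i \<in> {1..l}" and E: "m E \<in> N" "T (tensor (m E)) = 1 *\<^sub>R tensor (G (m E))"
      using insert by blast+
    note nonzero_upd[OF E(1) nonzeroD(2,3)[OF True i]] scalar_upd_eq[OF E(1) i nonzeroD(2,3)[OF True i] E(2)]
    ultimately show ?case by (simp del: fun_upd_apply)
  qed
  from this[of "{1..l}"] have m: "m {1..l} \<in> N" "T (tensor (m {1..l})) = tensor (G (m {1..l}))" by auto
  have "tensor (m {1..l}) = tensor x" by (rule tensor_cong[OF nonzeroD(1)[OF m(1)]]) (simp add: m_def)
  moreover have "tensor (G (m {1..l})) = tensor (G x)"
    by (rule tensor_cong[OF G_families]) (use \<tau>(1) in \<open>auto simp: m_def G_def\<close>)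
  ultimately show ?thesis using m by simp
next
  case False
  then obtain i where i: "i \<in> {1..l}" "x i = 0\<^sub>v (d i)" using x by (auto simp: nonzero_families_def)
  have "x = x(i := 0 \<cdot>\<^sub>v x i)" using i by (auto intro!: ext eq_vecI)
  then have "tensor (G x) = 0"
    using G_add_smult(2)[OF i(1) x familiesD[OF x i(1)] familiesD[OF x i(1)], of 0] by simp
  then show ?thesis using False x by (simp add: tensor_eq_0_iff[symmetric] blinfun.zero_right)
qed

section \<open>The adjoint and the polar decomposition\<close>

definition G' :: "(nat \<Rightarrow> real Matrix.vec) \<Rightarrow> nat \<Rightarrow> real Matrix.vec" where
  "G' y i = transpose_mat (B (\<sigma> i)) *\<^sub>v y (\<sigma> i)"

lemma G'_families: "G' y \<in> F"
proof -
  have "G' y i \<in> carrier_vec (d i)" if "i \<in> {1..l}" for i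
    using \<tau>_\<sigma>[OF that] unfolding G'_def by (intro carrier_vecI) (simp add: B_def)
  then show ?thesis by (simp add: vec_families_def)
qed

lemma linear_T: "linear (blinfun_apply T)" by (rule linear_blinfun)

lemma inner_adjoint_T: "inner (adjoint (blinfun_apply T) v) w = inner v (T w)"
  using adjoint_works[OF linear_T, of w v] by (simp add: inner_commute)

text \<open>Reindexing the product of scalar products by \<open>\<sigma>\<close> lets each
  \<open>B (\<sigma> i)\<close> move to the other side as its transpose.\<close>

lemma adjoint_T:
  assumes y: "y \<in> F"
  shows "adjoint (blinfun_apply T) (tensor y) = tensor (G' y)"
proof (rule tensor_ext)
  fix x assume x: "x \<in> F"
  have "inner (adjoint (blinfun_apply T) (tensor y)) (tensor x) = inner (tensor y) (tensor (G x))"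
    by (simp add: inner_adjoint_T T_tensor x)
  also have "\<dots> = (\<Prod>j\<in>{1..l}. scalar_prod (y j) (G x j))" by (rule inner_tensor[OF y G_families])
  also have "\<dots> = (\<Prod>i\<in>{1..l}. scalar_prod (y (\<sigma> i)) (G x (\<sigma> i)))"
    by (rule prod.reindex_bij_betw[OF \<sigma>_bij, symmetric])
  also have "\<dots> = (\<Prod>i\<in>{1..l}. scalar_prod (G' y i) (x i))"
  proof (intro prod.cong refl)
    fix i assume i: "i \<in> {1..l}"
    have "B (\<sigma> i) \<in> carrier_mat (d (\<sigma> i)) (d i)" using B_carrier[of "\<sigma> i"] \<tau>_\<sigma>[OF i] by simp
    from mat_mult_transpose_scalar_prod[OF this familiesD[OF y \<sigma>(1)[OF i]] familiesD[OF x i]]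
    show "scalar_prod (y (\<sigma> i)) (G x (\<sigma> i)) = scalar_prod (G' y i) (x i)"
      by (simp add: G_def G'_def \<tau>_\<sigma>[OF i])
  qed
  also have "\<dots> = inner (tensor (G' y)) (tensor x)" by (rule inner_tensor[OF G'_families x, symmetric])
  finally show "inner (adjoint (blinfun_apply T) (tensor y)) (tensor x) = inner (tensor (G' y)) (tensor x)" .
qed

text \<open>Otherwise the adjoint of \<open>T\<close> would kill a nonzero decomposable vector,
  which is impossible because \<open>T\<close> is onto.\<close>

lemma transpose_B_nonzero:
  assumes j: "j \<in> {1..l}" and u: "u \<in> carrier_vec (d j)" "u \<noteq> 0\<^sub>v (d j)"
  shows "transpose_mat (B j) *\<^sub>v u \<noteq> 0\<^sub>v (d (\<tau> j))"
proof
  assume 0: "transpose_mat (B j) *\<^sub>v u = 0\<^sub>v (d (\<tau> j))"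
  define y where "y = x0(j := u)"
  have y: "y \<in> N" unfolding y_def by (rule nonzero_upd[OF x0 u])
  have "G' y (\<tau> j) = 0\<^sub>v (d (\<tau> j))" using 0 \<tau>(2)[OF j] by (simp add: G'_def y_def)
  then have "G' y \<notin> N" using nonzeroD(3)[of "G' y" "\<tau> j"] \<tau>(1)[OF j] by blast
  then have "adjoint (blinfun_apply T) (tensor y) = 0"
    using adjoint_T[OF nonzeroD(1)[OF y]] tensor_eq_0_iff[OF G'_families] by simp
  moreover obtain v where "T v = tensor y" using bij_T by (metis bij_pointE)
  ultimately have "inner (tensor y) (tensor y) = 0" using inner_adjoint_T[of "tensor y" v] by simp
  then show False using y tensor_eq_0_iff[OF nonzeroD(1)[OF y]] by simp
qed

lemma strictly_positive_B:
  assumes j: "j \<in> {1..l}"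
  shows "strictly_positive (d j) (B j * transpose_mat (B j))"
proof -
  have Bt: "transpose_mat (B j) \<in> carrier_mat (d (\<tau> j)) (d j)" using B_carrier by simp
  have Btv: "transpose_mat (B j) *\<^sub>v x \<in> carrier_vec (d (\<tau> j))" if "x \<in> carrier_vec (d j)" for x
    using Bt that by (rule mult_mat_vec_carrier)
  have mv: "(B j * transpose_mat (B j)) *\<^sub>v x = B j *\<^sub>v (transpose_mat (B j) *\<^sub>v x)" if "x \<in> carrier_vec (d j)" for x
    by (rule assoc_mult_mat_vec[OF B_carrier Bt that])
  have sp: "scalar_prod x ((B j * transpose_mat (B j)) *\<^sub>v y) =
      scalar_prod (transpose_mat (B j) *\<^sub>v x) (transpose_mat (B j) *\<^sub>v y)"
    if "x \<in> carrier_vec (d j)" "y \<in> carrier_vec (d j)" for x y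
    unfolding mv[OF that(2)] by (rule mat_mult_transpose_scalar_prod[OF B_carrier that(1) Btv[OF that(2)]])
  show ?thesis
    unfolding strictly_positive_def
  proof (intro conjI ballI impI)
    show C: "B j * transpose_mat (B j) \<in> carrier_mat (d j) (d j)" using B_carrier Bt by (rule mult_carrier_mat)
    fix x y :: "real Matrix.vec" assume x: "x \<in> carrier_vec (d j)" and y: "y \<in> carrier_vec (d j)"
    have "scalar_prod ((B j * transpose_mat (B j)) *\<^sub>v x) y = scalar_prod y ((B j * transpose_mat (B j)) *\<^sub>v x)"
      by (rule comm_scalar_prod[OF mult_mat_vec_carrier[OF C x] y])
    also have "\<dots> = scalar_prod x ((B j * transpose_mat (B j)) *\<^sub>v y)"
      unfolding sp[OF x y] sp[OF y x] by (rule comm_scalar_prod[OF Btv[OF y] Btv[OF x]])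
    finally show "scalar_prod ((B j * transpose_mat (B j)) *\<^sub>v x) y = scalar_prod x ((B j * transpose_mat (B j)) *\<^sub>v y)" .
  next
    fix x :: "real Matrix.vec" assume x: "x \<in> carrier_vec (d j)" "x \<noteq> 0\<^sub>v (d j)"
    show "0 < scalar_prod x ((B j * transpose_mat (B j)) *\<^sub>v x)"
      unfolding sp[OF x(1) x(1)] by (rule scalar_prod_self_pos[OF Btv[OF x(1)] transpose_B_nonzero[OF j x]])
  qed
qed

text \<open>The permutations of the slots in \<open>T\<close> and in its adjoint cancel, so the
  composition acts on each slot separately.\<close>

lemma T_adjoint_T:
  assumes y: "y \<in> F"
  shows "T (adjoint (blinfun_apply T) (tensor y)) = tensor (\<lambda>j. (B j * transpose_mat (B j)) *\<^sub>v y j)"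
proof -
  have "T (adjoint (blinfun_apply T) (tensor y)) = tensor (G (G' y))"
    by (simp add: adjoint_T[OF y] T_tensor[OF G'_families])
  also have "\<dots> = tensor (\<lambda>j. (B j * transpose_mat (B j)) *\<^sub>v y j)"
  proof (rule tensor_cong[OF G_families])
    fix j assume j: "j \<in> {1..l}"
    show "G (G' y) j = (B j * transpose_mat (B j)) *\<^sub>v y j"
      using assoc_mult_mat_vec[of "B j" "d j" "d (\<tau> j)" "transpose_mat (B j)" "d j" "y j"] familiesD[OF y j] B_carrier[of j]
      by (simp add: G_def G'_def \<tau>(2)[OF j])
  qed
  finally show ?thesis .
qed

lemma polar_decomposition:
  obtains S U where "S \<in> A" "U \<in> O'" "S o\<^sub>L U = T"
proof -
  let ?P = "\<lambda>j. B j * transpose_mat (B j)"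
  have Pc: "?P i \<in> carrier_mat (d i) (d i)" if "i \<in> {1..l}" for i
    using strictly_positive_B[OF that] by (simp add: strictly_positive_def)
  obtain X where X: "tensor_of_maps ?P X" using ex_tensor_of_maps[of ?P] Pc by metis
  obtain S where S: "S \<in> A" "S o\<^sub>L S = X" using tensor_sqrt[OF dim strictly_positive_B X] by metis
  note Ssa = positive_tensors_self_adjoint[OF S(1)]
  have "blinfun_apply X = (\<lambda>v. T (adjoint (blinfun_apply T) v))"
  proof (rule blinfun_eq_on_tensors)
    show "linear (\<lambda>v. T (adjoint (blinfun_apply T) v))"
      using linear_compose[OF adjoint_linear[OF linear_T] linear_T] by (simp add: o_def)
  qed (use X T_adjoint_T in \<open>auto simp: is_tensor_of_maps_def\<close>)
  then have SS: "T (adjoint (blinfun_apply T) v) = S (S v)" for v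
    using S(2) by (metis blinfun_apply_blinfun_compose)
  obtain R where R: "S o\<^sub>L R = id_blinfun" "R o\<^sub>L S = id_blinfun" "R \<in> GL"
    using positive_tensors_inverse[OF S(1)] by metis
  have SR: "S (R v) = v" for v using R(1) by (metis blinfun_apply_blinfun_compose blinfun_apply_id_blinfun id_apply)
  define U where "U = R o\<^sub>L T"
  have SU: "S o\<^sub>L U = T" by (rule blinfun_eqI) (simp add: U_def SR)
  \<comment> \<open>\<open>V\<close> is the adjoint of \<open>U\<close>. It is isometric because
    \<open>S o\<^sub>L S\<close> is \<open>T\<close> after its adjoint, hence onto by finite
    dimension, and \<open>U\<close> is its inverse.\<close>
  define V where "V v = adjoint (blinfun_apply T) (R v)" for v
  have UV: "inner (U v) w = inner v (V w)" for v w
  proof -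
    have "inner (U v) w = inner (R (T v)) (S (R w))" by (simp add: U_def SR)
    also have "\<dots> = inner (S (R (T v))) (R w)" by (simp add: Ssa)
    also have "\<dots> = inner v (V w)" using adjoint_works[OF linear_T, of v "R w"] by (simp add: SR V_def)
    finally show ?thesis .
  qed
  have VV: "inner (V v) (V w) = inner v w" for v w
  proof -
    have "inner (V v) (V w) = inner (S (S (R v))) (R w)"
      using inner_adjoint_T[of "R w" "V v"] by (simp add: V_def SS inner_commute)
    also have "\<dots> = inner v (S (R w))" by (simp add: SR Ssa)
    finally show ?thesis by (simp add: SR)
  qed
  have "linear V"
    unfolding V_def using linear_compose[OF linear_blinfun[of R] adjoint_linear[OF linear_T]] by (simp add: o_def)
  then have "orthogonal_transformation V" using VV by (simp add: orthogonal_transformation_def)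
  then have "surj V" by (rule orthogonal_transformation_surj)
  have "inner (U v) (U w) = inner v w" for v w
  proof -
    have UVx: "U (V x) = x" for x
    proof (rule vector_eq_ldot[THEN iffD1, OF allI])
      fix z show "inner z (U (V x)) = inner z x" using UV[of "V x" z] VV[of x z] by (simp add: inner_commute)
    qed
    obtain v' w' where "v = V v'" "w = V w'" using \<open>surj V\<close> by (metis surjD)
    then show ?thesis by (simp add: UVx VV)
  qed
  then have "orthogonal_transformation (blinfun_apply U)"
    by (simp add: orthogonal_transformation_def linear_blinfun)
  moreover have "U \<in> GL" unfolding U_def by (rule GL_compose[OF R(3) T])
  ultimately show ?thesis using that[OF S(1) _ SU] by (simp add: O_tensor_def)
qed

end

section \<open>The polar decomposition homeomorphism\<close>

theorem lemmaA6:
  fixes l :: nat and d :: "nat \<Rightarrow> nat"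
    and tensor :: "(nat \<Rightarrow> real Matrix.vec) \<Rightarrow> 'v::euclidean_space"
  assumes "l \<ge> 2"
    and "\<forall>i\<in>{1..l}. d i \<ge> 2"
    and "euclidean_tensor_product l d tensor"
  shows "closedin (top_of_set (GL_tensor l d tensor)) (positive_tensors l d tensor) \<and>
    (\<exists>\<Phi>. homeomorphism (positive_tensors l d tensor \<times> O_tensor l d tensor) (GL_tensor l d tensor)
            (\<lambda>(S, U). S o\<^sub>L U) \<Phi>)"
proof -
  interpret tensor_space l d tensor using assms(3) by unfold_locales
  have dim: "d i \<ge> 2" if "i \<in> {1..l}" for i using assms(2) that by blast
  note sa = positive_tensors_self_adjoint
  have pos: "0 < inner v (S v)" if "S \<in> A" "v \<noteq> 0" for S v using positive_tensors_pos[OF _ that] dim by blast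
  have nonneg: "0 \<le> inner v (S v)" if "S \<in> A" for S v
    using pos[OF that, of v] by (cases "v = 0") (auto simp: less_imp_le)
  have polar: "\<exists>S U. S \<in> A \<and> U \<in> O' \<and> S o\<^sub>L U = T" if "T \<in> GL" for T
  proof -
    interpret tensor_preserver l d tensor T using that dim by unfold_locales auto
    show ?thesis using polar_decomposition by metis
  qed
  have orth: "orthogonal_transformation (blinfun_apply U)" if "U \<in> O'" for U using that by (simp add: O_tensor_def)
  have AGL: "S \<in> GL" if "S \<in> A" for S using positive_tensors_inverse[OF that] by metis
  \<comment> \<open>\<open>S'\<close> is only assumed self-adjoint and positive semidefinite, so
    that the closed set \<open>C\<close> below is covered too.\<close>
  have uniq: "S = S'"
    if S: "S \<in> A" and S': "\<And>x y. inner (blinfun_apply S' x) y = inner x (S' y)" "\<And>x. 0 \<le> inner x (S' x)"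
      and U: "orthogonal_transformation (blinfun_apply U)" "orthogonal_transformation (blinfun_apply U')"
      and eq: "S o\<^sub>L U = S' o\<^sub>L U'" for S S' U U' :: "'v \<Rightarrow>\<^sub>L 'v"
  proof -
    obtain m where m: "m > 0" "\<And>x. m * (norm x)^2 \<le> inner x (S x)"
      using positive_lower_bound[of S] pos[OF S] by metis
    have "m * norm (S - S') \<le> norm ((S o\<^sub>L U) - (S' o\<^sub>L U')) * (2 * norm S + norm ((S o\<^sub>L U) - (S' o\<^sub>L U')))"
      by (rule polar_decomposition_estimate) (fact sa[OF S] S' U m)+
    then have "m * norm (S - S') \<le> 0" by (simp add: eq)
    then show ?thesis using m(1) by (simp add: mult_le_0_iff)
  qed

  define C where "C = {X :: 'v \<Rightarrow>\<^sub>L 'v. (\<forall>x y. inner (X x) y = inner x (X y)) \<and> (\<forall>x. 0 \<le> inner x (X x))}"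
  have "closed C" unfolding C_def
    by (intro closed_Collect_conj closed_Collect_all closed_Collect_eq closed_Collect_le continuous_intros)
  moreover have "A = GL \<inter> C"
  proof
    show "A \<subseteq> GL \<inter> C" using AGL sa nonneg by (auto simp: C_def)
    show "GL \<inter> C \<subseteq> A"
    proof
      fix X assume X: "X \<in> GL \<inter> C"
      obtain S U where SU: "S \<in> A" "U \<in> O'" "S o\<^sub>L U = X" using polar X by blast
      \<comment> \<open>\<open>X\<close> times the identity is a second decomposition of
        \<open>X\<close>, with a semidefinite first factor.\<close>
      have "S = X"
        by (rule uniq[OF SU(1) _ _ orth[OF SU(2)], of X id_blinfun])
           (use X SU(3) in \<open>auto simp: C_def orthogonal_transformation_def linear_id intro!: blinfun_eqI\<close>)
      then show "X \<in> A" using SU by simp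
    qed
  qed
  ultimately have closed: "closedin (top_of_set GL) A" by (auto simp: closedin_closed)

  define \<Psi> :: "('v \<Rightarrow>\<^sub>L 'v) \<times> ('v \<Rightarrow>\<^sub>L 'v) \<Rightarrow> 'v \<Rightarrow>\<^sub>L 'v" where "\<Psi> = (\<lambda>(S, U). S o\<^sub>L U)"
  define \<Phi> where "\<Phi> = inv_into (A \<times> O') \<Psi>"
  have inj: "inj_on \<Psi> (A \<times> O')"
  proof (rule inj_onI, clarify)
    fix S U S' U' assume S: "S \<in> A" "S' \<in> A" and U: "U \<in> O'" "U' \<in> O'" and "\<Psi> (S, U) = \<Psi> (S', U')"
    then have eq: "S o\<^sub>L U = S' o\<^sub>L U'" by (simp add: \<Psi>_def)
    have SS: "S = S'" by (rule uniq[OF S(1) sa[OF S(2)] nonneg[OF S(2)] orth[OF U(1)] orth[OF U(2)] eq])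
    have "inj (blinfun_apply S)" using AGL[OF S(1)] by (simp add: GL_tensor_def bij_def)
    moreover have "S (U x) = S (U' x)" for x using eq SS by (metis blinfun_apply_blinfun_compose)
    ultimately have "U = U'" by (intro blinfun_eqI) (metis injD)
    with SS show "S = S' \<and> U = U'" by simp
  qed
  have img: "\<Psi> ` (A \<times> O') = GL"
  proof
    show "\<Psi> ` (A \<times> O') \<subseteq> GL" using AGL GL_compose by (auto simp: \<Psi>_def O_tensor_def)
    show "GL \<subseteq> \<Psi> ` (A \<times> O')" using polar by (force simp: \<Psi>_def)
  qed
  have bij: "bij_betw \<Psi> (A \<times> O') GL" using inj img by (simp add: bij_betw_def)
  have \<Psi>\<Phi>: "\<Psi> (\<Phi> T) = T" if "T \<in> GL" for T using bij_betw_inv_into_right[OF bij that] by (simp add: \<Phi>_def)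
  have \<Phi>in: "\<Phi> T \<in> A \<times> O'" if "T \<in> GL" for T
    using bij_betwE[OF bij_betw_inv_into[OF bij]] that by (simp add: \<Phi>_def)
  have cont: "continuous_on GL \<Phi>"
    unfolding continuous_on_def
  proof
    fix T0 assume T0: "T0 \<in> GL"
    obtain S0 U0 where S0U0: "\<Phi> T0 = (S0, U0)" by fastforce
    then have S0: "S0 \<in> A" and U0: "U0 \<in> O'" and T0': "S0 o\<^sub>L U0 = T0"
      using \<Phi>in[OF T0] \<Psi>\<Phi>[OF T0] by (auto simp: \<Psi>_def)
    obtain m where m: "m > 0" "\<And>x. m * (norm x)^2 \<le> inner x (S0 x)"
      using positive_lower_bound[of S0] pos[OF S0] by metis
    obtain R where R: "R o\<^sub>L S0 = id_blinfun" using positive_tensors_inverse[OF S0] by metis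
    then have RS: "R (S0 x) = x" for x by (metis blinfun_apply_blinfun_compose blinfun_apply_id_blinfun id_apply)
    define e where "e T = norm (T0 - T)" for T
    \<comment> \<open>The bound on \<open>norm (S0 - S)\<close> given by
      \<open>polar_decomposition_estimate\<close>; \<open>m\<close> and \<open>S0\<close> are fixed,
      so it vanishes with \<open>e T\<close>.\<close>
    define h where "h T = e T * (2 * norm S0 + e T) / m" for T
    have bounds: "norm (fst (\<Phi> T) - S0) \<le> h T" "norm (snd (\<Phi> T) - U0) \<le> norm R * (e T + h T)" if T: "T \<in> GL" for T
    proof -
      obtain S U where SU: "\<Phi> T = (S, U)" by fastforce
      then have S: "S \<in> A" and U: "U \<in> O'" and T': "S o\<^sub>L U = T"
        using \<Phi>in[OF T] \<Psi>\<Phi>[OF T] by (auto simp: \<Psi>_def)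
      have 1: "norm (S0 - S) \<le> h T"
      proof -
        have "m * norm (S0 - S) \<le> norm ((S0 o\<^sub>L U0) - (S o\<^sub>L U)) * (2 * norm S0 + norm ((S0 o\<^sub>L U0) - (S o\<^sub>L U)))"
          by (rule polar_decomposition_estimate) (fact sa[OF S0] sa[OF S] orth[OF U0] orth[OF U] m nonneg[OF S])+
        then show ?thesis using m(1) by (simp add: T0' T' h_def e_def pos_le_divide_eq mult.commute)
      qed
      then show "norm (fst (\<Phi> T) - S0) \<le> h T" by (simp add: SU norm_minus_commute)
      \<comment> \<open>From \<open>T0 = S0 U0\<close> and \<open>T = S U\<close> one gets
        \<open>S0 (U0 - U) = (T0 - T) - (S0 - S) U\<close>, and \<open>R\<close> cancels
        \<open>S0\<close>.\<close>
      have "U0 - U = R o\<^sub>L ((T0 - T) - ((S0 - S) o\<^sub>L U))"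
        by (rule blinfun_eqI)
           (simp add: T0'[symmetric] T'[symmetric] blinfun.diff_left blinfun.diff_right RS)
      then have "norm (U0 - U) \<le> norm R * norm ((T0 - T) - ((S0 - S) o\<^sub>L U))"
        by (simp add: norm_blinfun_compose)
      also have "norm ((T0 - T) - ((S0 - S) o\<^sub>L U)) \<le> e T + norm (S0 - S) * norm U"
        unfolding e_def by (rule order_trans[OF norm_triangle_ineq4 add_mono[OF order_refl norm_blinfun_compose]])
      also have "norm (S0 - S) * norm U \<le> h T * 1"
        using 1 norm_orthogonal_le_1[OF orth[OF U]] by (intro mult_mono) (auto intro: order_trans[OF norm_ge_zero])
      finally show "norm (snd (\<Phi> T) - U0) \<le> norm R * (e T + h T)"
        by (simp add: SU norm_minus_commute mult_left_mono)
    qed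
    have ev: "eventually (\<lambda>T. T \<in> GL) (at T0 within GL)"
      unfolding eventually_at by (intro exI[of _ 1]) auto
    have e0: "(e \<longlongrightarrow> 0) (at T0 within GL)"
      unfolding e_def by (rule tendsto_eq_intros refl | simp)+
    have h0: "(h \<longlongrightarrow> 0) (at T0 within GL)"
      unfolding h_def using m by (auto intro!: tendsto_eq_intros e0)
    have eh0: "((\<lambda>T. norm R * (e T + h T)) \<longlongrightarrow> 0) (at T0 within GL)"
      by (auto intro!: tendsto_eq_intros e0 h0)
    have "((\<lambda>T. fst (\<Phi> T)) \<longlongrightarrow> S0) (at T0 within GL)"
      by (rule LIM_zero_cancel, rule Lim_null_comparison[OF eventually_mono[OF ev bounds(1)] h0])
    moreover have "((\<lambda>T. snd (\<Phi> T)) \<longlongrightarrow> U0) (at T0 within GL)"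
      by (rule LIM_zero_cancel, rule Lim_null_comparison[OF eventually_mono[OF ev bounds(2)] eh0])
    ultimately have "((\<lambda>T. (fst (\<Phi> T), snd (\<Phi> T))) \<longlongrightarrow> (S0, U0)) (at T0 within GL)"
      by (rule tendsto_Pair)
    then show "(\<Phi> \<longlongrightarrow> \<Phi> T0) (at T0 within GL)" by (simp add: S0U0)
  qed
  have "continuous_on (A \<times> O') \<Psi>"
    unfolding \<Psi>_def case_prod_beta by (intro bounded_bilinear.continuous_on[OF bounded_bilinear_blinfun_compose] continuous_intros)
  then have "homeomorphism (A \<times> O') GL \<Psi> \<Phi>"
    unfolding homeomorphism_def using img \<Psi>\<Phi> cont bij_betw_inv_into_left[OF bij] bij_betw_imp_surj_on[OF bij_betw_inv_into[OF bij]]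
    by (auto simp: \<Phi>_def)
  with closed show ?thesis unfolding \<Psi>_def by blast
qed

end
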